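(* Suppose that $p=p(n)$ and $\omega \log n \le d=pn \le n / \omega = o(n)$, where $\omega=\omega(n)$ is any function tending to infinity as $n \to \infty$ such that $\omega \le \log n$. Let $i=i(n) \in \mathbb{N}$ be the largest integer such that $d^i = o(n)$. Let $\hat{\omega} = \hat{\omega}(n) = \min( \sqrt{\omega}, n/d^i )$, so that $\hat{\omega}\to \infty$ as $n \to \infty$. Finally, suppose that $d^{i+1} / n \gg \hat{\omega} \log n$. Then the following property holds asymptotically almost surely for $G = (V,E) \in \mathcal{G}(n,p)$: $$ \mathrm{eq}(G) \le (2+o(1)) \frac {n \log n}{d^i} = O \left( \frac {n \log n}{d^i} \right). $$
   Context: Query game on a simple graph $G=(V,E)$: $d_G(u,v)$ denotes the graph distance. An adversary fixes a target vertex $v^*\in V$ unknown to an adaptive algorithm. In each round the algorithm makes an edge query, i.e. selects two adjacent vertices $u,v\in V$, and the adversary replies with whichever of $u,v$ is closer to $v^*$ (with either one, at the adversary's choice, if $d_G(u,v^* )=d_G(v,v^* )$). Equivalently: put $V_0=V$; in round $t$ the algorithm presents adjacent $(u_t,v_t)$ (depending on $G$ and earlier replies) and the adversary chooses either $V_t=\{x\in V_{t-1}: d_G(u_t,x)\le d_G(v_t,x)\}$ (reply $u_t$) or $V_t=\{x\in V_{t-1}: d_G(v_t,x)\le d_G(u_t,x)\}$ (reply $v_t$); the target is located once $|V_t|=1$. $\mathrm{eq}(G)$ is the least integer $t$ such that the algorithm can locate the target in at most $t$ edge queries, regardless of the strategy of the adversary. $\mathcal{G}(n,p)$ is the binomial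 random graph on vertex set $\{1,\dots,n\}$, each pair being an edge independently with probability $p=p(n)$. A property holds asymptotically almost surely (a.a.s.) if its probability tends to $1$ as $n\to\infty$. $\log$ is the natural logarithm, $\mathbb{N}=\{1,2,\dots\}$, and asymptotic notation is as $n\to\infty$; $f\gg g$ means $g=o(f)$. Here $o(1)$ denotes some deterministic function of $n$ tending to $0$. *)

theory Defs
  imports "HOL-Probability.Probability" "HOL-Library.Landau_Symbols"
begin

text \<open>A simple graph is given by its vertex set \<open>V\<close> and its set \<open>E\<close> of edges, each edge
  being a two-element subset of \<open>V\<close>.\<close>

definition walk :: "'a set \<Rightarrow> 'a set set \<Rightarrow> 'a list \<Rightarrow> bool" where
  "walk V E xs \<longleftrightarrow> xs \<noteq> [] \<and> set xs \<subseteq> V \<and> successively (\<lambda>u v. {u, v} \<in> E) xs"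

text \<open>Vertices in different components are at distance \<open>\<infinity>\<close>.\<close>

definition gdist :: "'a set \<Rightarrow> 'a set set \<Rightarrow> 'a \<Rightarrow> 'a \<Rightarrow> enat" where
  "gdist V E u v =
    (INF xs \<in> {xs. walk V E xs \<and> hd xs = u \<and> last xs = v}. enat (length xs - 1))"

text \<open>An algorithm maps the history of replies (most recent reply first) to the edge it queries
  next. A reply is an endpoint \<open>w\<close> of the queried edge. The history \<open>h\<close> is a truthful play
  against the target \<open>x\<close> iff \<open>x \<in> candidates V E alg h\<close>; in particular, histories with an empty
  candidate set are not open to the adversary.\<close>

primrec candidates :: "'a set \<Rightarrow> 'a set set \<Rightarrow> ('a list \<Rightarrow> 'a set) \<Rightarrow> 'a list \<Rightarrow> 'a set" where
  "candidates V E alg [] = V"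
| "candidates V E alg (w # h) =
    {x \<in> candidates V E alg h. w \<in> alg h \<and> (\<forall>y \<in> alg h. gdist V E w x \<le> gdist V E y x)}"

text \<open>Whatever the target and the truthful replies so far, either the target has been located, or
  fewer than \<open>t\<close> queries have been made and the algorithm continues with a legal query. Queries
  made after the target has been located are irrelevant.\<close>

definition locates_within :: "'a set \<Rightarrow> 'a set set \<Rightarrow> ('a list \<Rightarrow> 'a set) \<Rightarrow> nat \<Rightarrow> bool" where
  "locates_within V E alg t \<longleftrightarrow>
    (\<forall>target \<in> V. \<forall>h. target \<in> candidates V E alg h \<longrightarrow>
      card (candidates V E alg h) = 1 \<or> (alg h \<in> E \<and> length h < t))"

text \<open>The value is \<open>\<infinity>\<close> if no algorithm succeeds (which can only happen for disconnected graphs).\<close>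

definition eq_num :: "'a set \<Rightarrow> 'a set set \<Rightarrow> enat" where
  "eq_num V E = Inf {enat t | t. \<exists>alg. locates_within V E alg t}"

text \<open>The distribution of the edge set of the binomial random graph on \<open>{1..n}\<close>.\<close>

definition gnp :: "nat \<Rightarrow> real \<Rightarrow> nat set set pmf" where
  "gnp n p =
    map_pmf (\<lambda>f. {e. f e})
      (Pi_pmf {e. e \<subseteq> {1..n} \<and> card e = 2} False (\<lambda>_. bernoulli_pmf p))"

definition aas :: "(nat \<Rightarrow> 'a pmf) \<Rightarrow> (nat \<Rightarrow> 'a \<Rightarrow> bool) \<Rightarrow> bool" where
  "aas M P \<longleftrightarrow> (\<lambda>n. measure_pmf.prob (M n) {x. P n x}) \<longlonglongrightarrow> 1"

text \<open>``The largest integer \<open>i = i(n)\<close> such that \<open>d\<^sup>i = o(n)\<close>'': since the condition is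
  asymptotic, \<open>i\<close> is maximal, for large \<open>n\<close>, among all functions satisfying it.\<close>

definition largest_exponent :: "(nat \<Rightarrow> real) \<Rightarrow> (nat \<Rightarrow> nat) \<Rightarrow> bool" where
  "largest_exponent d i \<longleftrightarrow>
    (\<forall>n. i n \<ge> 1) \<and> (\<lambda>n. d n ^ i n) \<in> o(\<lambda>n. real n) \<and>
    (\<forall>j :: nat \<Rightarrow> nat. (\<lambda>n. d n ^ j n) \<in> o(\<lambda>n. real n) \<longrightarrow> (\<forall>\<^sub>F n in sequentially. j n \<le> i n))"

end

theory Submission
  imports Defs
begin

text \<open>Put \<open>D = d\<^sup>i\<close> and write \<open>B x\<close> for the ball of radius \<open>i\<close> around \<open>x\<close>. The set of candidates \<open>W\<close>
  is shrunk in two phases. As long as \<open>|W| \<ge> n log n / (2D)\<close>, some edge \<open>{u, v}\<close> has the property that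
  either reply removes at least \<open>(3/4) (D/n) |W|\<close> candidates; this takes at most \<open>(4/3) n log n / D\<close>
  queries. Afterwards each query on the first edge of a shortest path between two candidates removes at
  least one of them, which takes \<open>n log n / (2D)\<close> more. The sum is below \<open>2 n log n / D\<close>, so that
  even \<open>\<epsilon> = 0\<close> works.

  The splitting edge comes from a second moment argument, uniform in \<open>W\<close>, which rests on
  \<open>|B x| \<approx> D\<close>, on \<open>|B x \<inter> B y| \<lesssim> D\<^sup>2 / n\<close> for \<open>x \<noteq> y\<close>, and on the sparsity of the graph inside the balls.
  These estimates follow from Chernoff bounds for breadth-first search: once the balls of radius
  \<open>j - 1\<close> and \<open>j\<close> are revealed, the edges between the \<open>j\<close>-th sphere and the unexplored vertices are
  still independent. Relative errors \<open>\<delta> / 2\<^sup>j\<close> at radius \<open>j\<close> keep the accumulated error bounded although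
  \<open>i\<close> may grow.\<close>

section \<open>Independence and Chernoff bounds for random subsets\<close>

text \<open>The obstacle is adaptivity: \<open>W\<close> depends on the graph through the replies,
  and failure probabilities of order \<open>1 / n^4\<close> cannot pay for all \<open>2^n\<close>
  sets \<open>W\<close>. Probability is therefore spent only on single vertices, pairs, sets of the
  size of a ball, large vertex sets and cuts; finding the splitting edge is then a deterministic
  count, valid for every large \<open>W\<close>.

  The threshold \<open>n log n / (2D)\<close> makes \<open>\<mu> = |W| D / n\<close> at least
  \<open>(log n) / 2\<close>. The \<open>|W|\<close> diagonal pairs, whose intersections have order
  \<open>D\<close> instead of \<open>D^2 / n\<close>, are then negligible in the second moment.

  The lower bound on \<open>d^(i+1)\<close> enters through the intersections. These contain the
  offspring of early meetings, whose number is controlled only up to an additive error of order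
  \<open>log n\<close>. Such errors grow to order \<open>(log n) d^(i-1)\<close>, which is
  negligible against the main term \<open>D^2 / n\<close> precisely when \<open>d^(i+1)\<close> is
  much larger than \<open>n log n\<close>.\<close>

definition random_subset :: "'a set \<Rightarrow> real \<Rightarrow> 'a set pmf" where
  "random_subset K p = map_pmf (\<lambda>f. {e. f e}) (Pi_pmf K False (\<lambda>_. bernoulli_pmf p))"

text \<open>Independence is expressed through the coordinates that a function reads: reading
  disjoint sets suffices. \<open>J\<close> is only an upper bound and may leave the ground
  set.\<close>

definition depends_on :: "'a set \<Rightarrow> ('a set \<Rightarrow> 'b) \<Rightarrow> bool" where
  "depends_on J f \<longleftrightarrow> (\<forall>E E'. E \<inter> J = E' \<inter> J \<longrightarrow> f E = f E')"

lemma depends_onI: "(\<And>E E'. E \<inter> J = E' \<inter> J \<Longrightarrow> f E = f E') \<Longrightarrow> depends_on J f"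
  unfolding depends_on_def by blast

lemma depends_onD: "depends_on J f \<Longrightarrow> E \<inter> J = E' \<inter> J \<Longrightarrow> f E = f E'"
  unfolding depends_on_def by blast

lemma depends_on_mono:
  assumes "depends_on J f" "J \<subseteq> J'"
  shows "depends_on J' f"
proof (rule depends_onI)
  fix E E' assume "E \<inter> J' = E' \<inter> J'"
  then have "E \<inter> J = E' \<inter> J" using assms(2) by blast
  then show "f E = f E'" using assms(1) by (rule depends_onD[rotated])
qed

lemma depends_on_comp: "depends_on J f \<Longrightarrow> depends_on J (\<lambda>E. g (f E))"
  by (metis depends_on_def)

lemma depends_on_comp2:
  "depends_on J f \<Longrightarrow> depends_on J g \<Longrightarrow> depends_on J (\<lambda>E. h (f E) (g E))"
  unfolding depends_on_def by metis

lemma depends_on_ball: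
  assumes "\<And>z. z \<in> Z \<Longrightarrow> depends_on J (P z)"
  shows "depends_on J (\<lambda>E. {z \<in> Z. P z E})"
proof (rule depends_onI)
  fix E E' :: "'b set" assume "E \<inter> J = E' \<inter> J"
  then have "P z E = P z E'" if "z \<in> Z" for z using assms[OF that] depends_onD by blast
  then show "{z \<in> Z. P z E} = {z \<in> Z. P z E'}" by blast
qed

lemma depends_on_prod:
  fixes f :: "'z \<Rightarrow> 'a set \<Rightarrow> real"
  assumes "\<And>z. z \<in> Z \<Longrightarrow> depends_on (J z) (f z)"
  shows "depends_on (\<Union>z\<in>Z. J z) (\<lambda>E. \<Prod>z\<in>Z. f z E)"
proof (rule depends_onI)
  fix E E' assume eq: "E \<inter> (\<Union>z\<in>Z. J z) = E' \<inter> (\<Union>z\<in>Z. J z)"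
  show "(\<Prod>z\<in>Z. f z E) = (\<Prod>z\<in>Z. f z E')"
  proof (rule prod.cong[OF refl])
    fix z assume "z \<in> Z"
    then have "E \<inter> J z = E' \<inter> J z" using eq by blast
    then show "f z E = f z E'" using assms[OF \<open>z \<in> Z\<close>] depends_onD by blast
  qed
qed

lemma set_random_subset: "finite K \<Longrightarrow> set_pmf (random_subset K p) \<subseteq> Pow K"
  using set_Pi_pmf_subset[of K False "\<lambda>_. bernoulli_pmf p"]
  by (auto simp: random_subset_def)

lemma finite_set_random_subset: "finite K \<Longrightarrow> finite (set_pmf (random_subset K p))"
  by (rule finite_subset[OF set_random_subset]) auto

lemma random_subset_union:
  assumes "finite A" "finite B" "A \<inter> B = {}"
  shows "random_subset (A \<union> B) p =
    map_pmf (\<lambda>(X, Y). X \<union> Y) (pair_pmf (random_subset A p) (random_subset B p))"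
proof -
  let ?P = "\<lambda>A. Pi_pmf A False (\<lambda>_. bernoulli_pmf p)"
  have "random_subset (A \<union> B) p =
      map_pmf (\<lambda>(f, g). {e. if e \<in> A then f e else g e}) (pair_pmf (?P A) (?P B))"
    unfolding random_subset_def Pi_pmf_union[OF assms] by (simp add: pmf.map_comp o_def case_prod_unfold)
  also have "\<dots> = map_pmf (\<lambda>(f, g). {e. f e} \<union> {e. g e}) (pair_pmf (?P A) (?P B))"
  proof (rule map_pmf_cong[OF refl])
    fix h assume "h \<in> set_pmf (pair_pmf (?P A) (?P B))"
    then have "\<forall>x. x \<notin> A \<longrightarrow> \<not> fst h x" "\<forall>x. x \<notin> B \<longrightarrow> \<not> snd h x"
      using set_Pi_pmf_subset[OF assms(1), of False "\<lambda>_. bernoulli_pmf p"]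
        set_Pi_pmf_subset[OF assms(2), of False "\<lambda>_. bernoulli_pmf p"]
      by (auto simp del: set_Pi_pmf_subset)
    then show "(case h of (f, g) \<Rightarrow> {e. if e \<in> A then f e else g e}) =
        (case h of (f, g) \<Rightarrow> {e. f e} \<union> {e. g e})"
      using assms(3) by (auto simp: case_prod_unfold split: if_splits)
  qed
  also have "\<dots> = map_pmf (\<lambda>(X, Y). X \<union> Y) (pair_pmf (random_subset A p) (random_subset B p))"
    unfolding random_subset_def by (simp add: map_pair[symmetric] pmf.map_comp o_def case_prod_unfold)
  finally show ?thesis .
qed

text \<open>Splitting \<open>K\<close> into its part inside \<open>J\<close> and the rest turns the
  law into a product: \<open>f\<close> sees only the first factor, and \<open>g\<close>, which
  avoids \<open>J\<close>, only the second.\<close>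

lemma expectation_mult_depends_on:
  fixes f g :: "'a set \<Rightarrow> real"
  assumes K: "finite K" and f: "depends_on J f" and g: "depends_on J' g" and disj: "J \<inter> J' = {}"
  shows "measure_pmf.expectation (random_subset K p) (\<lambda>E. f E * g E) =
    measure_pmf.expectation (random_subset K p) f * measure_pmf.expectation (random_subset K p) g"
proof -
  define A where "A = K \<inter> J"
  define B where "B = K - J"
  define M where "M = random_subset A p"
  define N where "N = random_subset B p"
  have fin: "finite A" "finite B" and AB: "A \<inter> B = {}" and KAB: "K = A \<union> B"
    using K by (auto simp: A_def B_def)
  have split: "measure_pmf.expectation (random_subset K p) h =
      (\<Sum>X\<in>Pow A. \<Sum>Y\<in>Pow B. h (X \<union> Y) * (pmf M X * pmf N Y))" for h :: "'a set \<Rightarrow> real"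
  proof -
    have "measure_pmf.expectation (random_subset K p) h =
        measure_pmf.expectation (pair_pmf M N) (\<lambda>(X, Y). h (X \<union> Y))"
      unfolding KAB random_subset_union[OF fin AB] M_def N_def
      by (simp add: case_prod_unfold)
    also have "\<dots> = (\<Sum>z\<in>Pow A \<times> Pow B. (case z of (X, Y) \<Rightarrow> h (X \<union> Y)) * pmf (pair_pmf M N) z)"
      using set_random_subset[OF fin(1), of p] set_random_subset[OF fin(2), of p] fin
      by (intro integral_measure_pmf_real) (auto simp: M_def N_def)
    also have "\<dots> = (\<Sum>X\<in>Pow A. \<Sum>Y\<in>Pow B. h (X \<union> Y) * (pmf M X * pmf N Y))"
      by (simp add: sum.cartesian_product pmf_pair case_prod_unfold)
        (auto intro!: sum.cong simp: pmf_pair case_prod_unfold)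
    finally show ?thesis .
  qed
  have fX: "f (X \<union> Y) = f X" if "X \<subseteq> A" "Y \<subseteq> B" for X Y
    using that by (intro depends_onD[OF f]) (auto simp: A_def B_def)
  have gY: "g (X \<union> Y) = g Y" if "X \<subseteq> A" "Y \<subseteq> B" for X Y
    using that disj by (intro depends_onD[OF g]) (auto simp: A_def B_def)
  have one: "(\<Sum>X\<in>Pow A. pmf M X) = 1" "(\<Sum>Y\<in>Pow B. pmf N Y) = 1"
    using sum_pmf_eq_1[of "Pow A" M] sum_pmf_eq_1[of "Pow B" N] fin
      set_random_subset[OF fin(1), of p] set_random_subset[OF fin(2), of p]
    by (auto simp: M_def N_def)
  have "measure_pmf.expectation (random_subset K p) f =
      (\<Sum>X\<in>Pow A. \<Sum>Y\<in>Pow B. (f X * pmf M X) * pmf N Y)"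
    unfolding split by (intro sum.cong refl) (simp add: fX)
  also have "\<dots> = (\<Sum>X\<in>Pow A. f X * pmf M X)"
    by (simp add: sum_distrib_left[symmetric] one)
  finally have ef: "measure_pmf.expectation (random_subset K p) f = (\<Sum>X\<in>Pow A. f X * pmf M X)" .
  have "measure_pmf.expectation (random_subset K p) g =
      (\<Sum>X\<in>Pow A. \<Sum>Y\<in>Pow B. pmf M X * (g Y * pmf N Y))"
    unfolding split by (intro sum.cong refl) (simp add: gY)
  also have "\<dots> = (\<Sum>Y\<in>Pow B. g Y * pmf N Y)"
    by (simp add: sum_distrib_left[symmetric] sum_distrib_right[symmetric] one)
  finally have eg: "measure_pmf.expectation (random_subset K p) g = (\<Sum>Y\<in>Pow B. g Y * pmf N Y)" .
  have "measure_pmf.expectation (random_subset K p) (\<lambda>E. f E * g E) =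
      (\<Sum>X\<in>Pow A. \<Sum>Y\<in>Pow B. (f X * pmf M X) * (g Y * pmf N Y))"
    unfolding split by (intro sum.cong refl) (simp add: fX gY)
  also have "\<dots> = (\<Sum>X\<in>Pow A. f X * pmf M X) * (\<Sum>Y\<in>Pow B. g Y * pmf N Y)"
    by (simp add: sum_product)
  finally show ?thesis by (simp add: ef eg)
qed

lemma expectation_prod_depends_on:
  fixes f :: "'z \<Rightarrow> 'a set \<Rightarrow> real"
  assumes K: "finite K" and Z: "finite Z"
    and f: "\<And>z. z \<in> Z \<Longrightarrow> depends_on (J z) (f z)" and disj: "disjoint_family_on J Z"
  shows "measure_pmf.expectation (random_subset K p) (\<lambda>E. \<Prod>z\<in>Z. f z E) =
    (\<Prod>z\<in>Z. measure_pmf.expectation (random_subset K p) (f z))"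
  using Z f disj
proof (induction Z)
  case (insert z Z)
  have "J z \<inter> (\<Union>y\<in>Z. J y) = {}"
    using insert.prems(2) insert.hyps(2) by (fastforce simp: disjoint_family_on_def)
  then have "measure_pmf.expectation (random_subset K p) (\<lambda>E. f z E * (\<Prod>z\<in>Z. f z E)) =
      measure_pmf.expectation (random_subset K p) (f z) *
      measure_pmf.expectation (random_subset K p) (\<lambda>E. \<Prod>z\<in>Z. f z E)"
    using insert.prems(1)
    by (intro expectation_mult_depends_on[OF K _ depends_on_prod]) auto
  moreover have "disjoint_family_on J Z"
    using insert.prems(2) by (auto simp: disjoint_family_on_def)
  ultimately show ?case using insert by simp
qed simp

lemma expectation_of_bool:
  "measure_pmf.expectation M (\<lambda>x. of_bool (P x)) = measure_pmf.prob M {x. P x}"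
proof -
  have "(\<lambda>x. of_bool (P x)) = (indicator {x. P x} :: _ \<Rightarrow> real)" by (auto simp: fun_eq_iff)
  then show ?thesis by simp
qed

lemma prob_conj_depends_on:
  assumes "finite K" "depends_on J P" "depends_on J' Q" "J \<inter> J' = {}"
  shows "measure_pmf.prob (random_subset K p) {E. P E \<and> Q E} =
    measure_pmf.prob (random_subset K p) {E. P E} * measure_pmf.prob (random_subset K p) {E. Q E}"
  using expectation_mult_depends_on[OF assms(1) depends_on_comp[OF assms(2), of of_bool]
      depends_on_comp[OF assms(3), of of_bool] assms(4), of p]
  by (simp add: expectation_of_bool flip: of_bool_conj)

lemma prob_all_depends_on:
  assumes "finite K" "finite Z" "\<And>z. z \<in> Z \<Longrightarrow> depends_on (J z) (P z)" "disjoint_family_on J Z"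
  shows "measure_pmf.prob (random_subset K p) {E. \<forall>z\<in>Z. P z E} =
    (\<Prod>z\<in>Z. measure_pmf.prob (random_subset K p) {E. P z E})"
proof -
  have eq: "of_bool (\<forall>z\<in>Z. P z E) = (\<Prod>z\<in>Z. of_bool (P z E) :: real)" for E
    using assms(2) by (induction Z) auto
  have "measure_pmf.expectation (random_subset K p) (\<lambda>E. \<Prod>z\<in>Z. of_bool (P z E) :: real) =
    (\<Prod>z\<in>Z. measure_pmf.expectation (random_subset K p) (\<lambda>E. of_bool (P z E)))"
    by (rule expectation_prod_depends_on[OF assms(1,2) depends_on_comp[OF assms(3)] assms(4)])
  then show ?thesis by (simp add: expectation_of_bool flip: eq)
qed

lemma prob_member_random_subset:
  assumes "finite K" "e \<in> K" "0 \<le> p" "p \<le> 1"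
  shows "measure_pmf.prob (random_subset K p) {E. e \<in> E} = p"
proof -
  have "measure_pmf.prob (random_subset K p) {E. e \<in> E} =
      measure_pmf.prob (map_pmf (\<lambda>f. f e) (Pi_pmf K False (\<lambda>_. bernoulli_pmf p))) {True}"
    unfolding random_subset_def by (simp add: vimage_def)
  also have "\<dots> = p"
    using assms by (subst Pi_pmf_component) (auto simp: measure_pmf_single)
  finally show ?thesis .
qed

text \<open>Deferred decisions: \<open>X\<close> is what has been explored so far, and \<open>bad s\<close> inspects only coordinates
  that need not be read to find out that \<open>X = s\<close>.\<close>

lemma prob_revealed_le:
  assumes K: "finite K" and c: "0 \<le> c"
    and X: "\<And>s. depends_on (I s) (\<lambda>E. X E = s)" and bad: "\<And>s. s \<in> X ` Pow K \<Longrightarrow> depends_on (J s) (bad s)"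
    and disj: "\<And>s. s \<in> X ` Pow K \<Longrightarrow> I s \<inter> J s = {}"
    and le: "\<And>s. s \<in> X ` Pow K \<Longrightarrow> measure_pmf.prob (random_subset K p) {E. bad s E} \<le> c"
  shows "measure_pmf.prob (random_subset K p) {E. bad (X E) E} \<le> c"
proof -
  let ?M = "random_subset K p"
  let ?R = "X ` Pow K"
  have fin: "finite ?R" using K by simp
  have "measure_pmf.prob ?M {E. bad (X E) E} \<le>
      measure_pmf.prob ?M (\<Union>s\<in>?R. {E. X E = s \<and> bad s E})"
    using set_random_subset[OF K, of p]
    by (intro measure_pmf.finite_measure_mono_AE AE_pmfI) auto
  also have "\<dots> \<le> (\<Sum>s\<in>?R. measure_pmf.prob ?M {E. X E = s \<and> bad s E})"
    using fin by (intro measure_pmf.finite_measure_subadditive_finite) auto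
  \<comment> \<open>Each event \<open>X E = s\<close> is treated on its own, so the revealed set
    \<open>I s\<close> may vary with \<open>s\<close>; this is what admits adaptive
    exploration.\<close>
  also have "\<dots> = (\<Sum>s\<in>?R. measure_pmf.prob ?M {E. X E = s} * measure_pmf.prob ?M {E. bad s E})"
    by (intro sum.cong refl prob_conj_depends_on[OF K X bad disj])
  also have "\<dots> \<le> (\<Sum>s\<in>?R. measure_pmf.prob ?M {E. X E = s} * c)"
    using le by (intro sum_mono mult_left_mono) auto
  also have "\<dots> = c * measure_pmf.prob ?M (\<Union>s\<in>?R. {E. X E = s})"
    using fin by (subst measure_pmf.finite_measure_finite_Union)
      (auto simp: disjoint_family_on_def sum_distrib_left mult.commute)
  also have "\<dots> \<le> c * 1" using c by (intro mult_left_mono) auto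
  finally show ?thesis by simp
qed

text \<open>An indicator with mean \<open>r\<close> has exponential moment
  \<open>1 + (exp t - 1) r \<le> exp ((exp t - 1) r)\<close>, and independence multiplies these.
  Both signs of \<open>t\<close> are covered, one for each tail.\<close>

lemma expectation_exp_card:
  assumes K: "finite K" and Z: "finite Z"
    and P: "\<And>z. z \<in> Z \<Longrightarrow> depends_on (J z) (P z)" and disj: "disjoint_family_on J Z"
  shows "measure_pmf.expectation (random_subset K p) (\<lambda>E. exp (t * real (card {z\<in>Z. P z E})))
    \<le> exp ((exp t - 1) * (\<Sum>z\<in>Z. measure_pmf.prob (random_subset K p) {E. P z E}))"
proof -
  let ?M = "random_subset K p"
  have "measure_pmf.expectation ?M (\<lambda>E. exp (t * real (card {z\<in>Z. P z E}))) =
      measure_pmf.expectation ?M (\<lambda>E. \<Prod>z\<in>Z. exp (t * of_bool (P z E)))"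
  proof -
    have "t * real (card {z\<in>Z. P z E}) = (\<Sum>z\<in>Z. t * of_bool (P z E))" for E
      using Z by (simp add: sum_distrib_left[symmetric] Int_def)
    then show ?thesis by (simp only: exp_sum[OF Z])
  qed
  also have "\<dots> = (\<Prod>z\<in>Z. measure_pmf.expectation ?M (\<lambda>E. exp (t * of_bool (P z E))))"
    using P depends_on_comp[of _ _ "\<lambda>b. exp (t * of_bool b)"]
    by (intro expectation_prod_depends_on[OF K Z _ disj]) blast
  also have "\<dots> \<le> (\<Prod>z\<in>Z. exp ((exp t - 1) * measure_pmf.prob ?M {E. P z E}))"
  proof (rule prod_mono)
    fix z assume "z \<in> Z"
    have "measure_pmf.expectation ?M (\<lambda>E. exp (t * of_bool (P z E))) =
        measure_pmf.expectation ?M (\<lambda>E. 1 + (exp t - 1) * of_bool (P z E))"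
      by (intro Bochner_Integration.integral_cong) auto
    also have "\<dots> = 1 + (exp t - 1) * measure_pmf.prob ?M {E. P z E}"
      using finite_set_random_subset[OF K, of p]
      by (subst Bochner_Integration.integral_add)
        (auto simp: expectation_of_bool intro!: integrable_measure_pmf_finite)
    also have "\<dots> \<le> exp ((exp t - 1) * measure_pmf.prob ?M {E. P z E})"
      using exp_ge_add_one_self by blast
    finally show "0 \<le> measure_pmf.expectation ?M (\<lambda>E. exp (t * of_bool (P z E))) \<and>
        measure_pmf.expectation ?M (\<lambda>E. exp (t * of_bool (P z E)))
          \<le> exp ((exp t - 1) * measure_pmf.prob ?M {E. P z E})"
      by (simp add: integral_nonneg_AE)
  qed
  also have "\<dots> = exp ((exp t - 1) * (\<Sum>z\<in>Z. measure_pmf.prob ?M {E. P z E}))"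
    using Z by (simp add: exp_sum sum_distrib_left)
  finally show ?thesis .
qed

lemma prob_le_expectation_exp:
  assumes "finite (set_pmf M)" and "\<And>x. Q x \<Longrightarrow> 0 \<le> g x + c"
  shows "measure_pmf.prob M {x. Q x} \<le> measure_pmf.expectation M (\<lambda>x. exp (g x)) * exp c"
proof -
  have "measure_pmf.prob M {x. Q x} = measure_pmf.expectation M (\<lambda>x. of_bool (Q x))"
    by (simp add: expectation_of_bool)
  also have "\<dots> \<le> measure_pmf.expectation M (\<lambda>x. exp (g x) * exp c)"
    using assms by (intro integral_mono integrable_measure_pmf_finite)
      (auto simp: mult_exp_exp)
  finally show ?thesis by simp
qed

text \<open>Markov's inequality for \<open>exp (e * card)\<close>. The multiplicative slack absorbs
  the quadratic term of \<open>exp e\<close>, so the failure probability depends on \<open>e\<close>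
  and \<open>L\<close> alone; the same bound serves tiny early spheres and large late ones.\<close>

lemma chernoff_upper:
  assumes K: "finite K" and Z: "finite Z"
    and P: "\<And>z. z \<in> Z \<Longrightarrow> depends_on (J z) (P z)" and disj: "disjoint_family_on J Z"
    and mean: "(\<Sum>z\<in>Z. measure_pmf.prob (random_subset K p) {E. P z E}) \<le> m"
    and e: "0 < e" "e \<le> 1"
  shows "measure_pmf.prob (random_subset K p) {E. (1 + e) * m + L \<le> real (card {z\<in>Z. P z E})}
    \<le> exp (- e * L)"
proof -
  let ?M = "random_subset K p"
  have m: "0 \<le> m" using mean by (meson measure_nonneg order_trans sum_nonneg)
  have expe: "exp e \<le> 1 + e + e\<^sup>2" using exp_bound[of e] e by simp
  have "measure_pmf.prob ?M {E. (1 + e) * m + L \<le> real (card {z\<in>Z. P z E})} \<le>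
      measure_pmf.expectation ?M (\<lambda>E. exp (e * real (card {z\<in>Z. P z E})))
        * exp (- e * ((1 + e) * m + L))"
    using e finite_set_random_subset[OF K] by (intro prob_le_expectation_exp) auto
  also have "\<dots> \<le> exp ((exp e - 1) * m) * exp (- e * ((1 + e) * m + L))"
  proof (rule mult_right_mono)
    show "measure_pmf.expectation ?M (\<lambda>E. exp (e * real (card {z\<in>Z. P z E})))
        \<le> exp ((exp e - 1) * m)"
      using expectation_exp_card[OF K Z P disj, of p e] mean e
      by (smt (verit) exp_le_cancel_iff mult_left_mono one_le_exp_iff)
  qed simp
  also have "\<dots> = exp ((exp e - 1 - e - e\<^sup>2) * m - e * L)"
    by (simp add: mult_exp_exp algebra_simps power2_eq_square)
  also have "\<dots> \<le> exp (- e * L)"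
    using expe m by (simp add: mult_nonpos_nonneg)
  finally show ?thesis .
qed

lemma exp_minus_le:
  fixes y :: real
  assumes "0 \<le> y"
  shows "exp (- y) \<le> 1 - y + y\<^sup>2"
proof -
  have pos: "0 \<le> 1 - y + y\<^sup>2"
  proof -
    have "0 \<le> (y - 1/2)\<^sup>2 + 3/4" by simp
    then show ?thesis by (simp add: power2_eq_square algebra_simps)
  qed
  have "1 \<le> 1 + y * y\<^sup>2" using assms by simp
  also have "\<dots> = (1 - y + y\<^sup>2) * (1 + y)" by (simp add: algebra_simps power2_eq_square)
  also have "\<dots> \<le> (1 - y + y\<^sup>2) * exp y" using pos by (intro mult_left_mono exp_ge_add_one_self)
  finally show ?thesis by (simp add: exp_minus field_simps)
qed

lemma chernoff_lower:
  assumes K: "finite K" and Z: "finite Z"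
    and P: "\<And>z. z \<in> Z \<Longrightarrow> depends_on (J z) (P z)" and disj: "disjoint_family_on J Z"
    and mean: "m \<le> (\<Sum>z\<in>Z. measure_pmf.prob (random_subset K p) {E. P z E})" and m: "0 \<le> m"
    and e: "0 < e" "e \<le> 1"
  shows "measure_pmf.prob (random_subset K p) {E. real (card {z\<in>Z. P z E}) \<le> (1 - e) * m - L}
    \<le> exp (- e * L)"
proof -
  let ?M = "random_subset K p"
  have expe: "exp (-e) \<le> 1 - e + e\<^sup>2" using e by (intro exp_minus_le) simp
  have "measure_pmf.prob ?M {E. real (card {z\<in>Z. P z E}) \<le> (1 - e) * m - L} \<le>
      measure_pmf.expectation ?M (\<lambda>E. exp ((-e) * real (card {z\<in>Z. P z E})))
        * exp (e * ((1 - e) * m - L))"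
    using e finite_set_random_subset[OF K] by (intro prob_le_expectation_exp) auto
  also have "\<dots> \<le> exp ((exp (-e) - 1) * m) * exp (e * ((1 - e) * m - L))"
  proof (rule mult_right_mono)
    show "measure_pmf.expectation ?M (\<lambda>E. exp ((-e) * real (card {z\<in>Z. P z E})))
        \<le> exp ((exp (-e) - 1) * m)"
      using expectation_exp_card[OF K Z P disj, of p "-e"] mean e
      by (smt (verit) exp_le_cancel_iff mult_left_mono_neg exp_le_one_iff)
  qed simp
  also have "\<dots> = exp ((exp (-e) - 1 + e - e\<^sup>2) * m - e * L)"
    by (simp add: mult_exp_exp algebra_simps power2_eq_square)
  also have "\<dots> \<le> exp (- e * L)"
    using expe m by (simp add: mult_nonpos_nonneg)
  finally show ?thesis .
qed

section \<open>Balls and the query game\<close>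

definition nbrs :: "'a set \<Rightarrow> 'a set set \<Rightarrow> 'a set \<Rightarrow> 'a set" where
  "nbrs V E A = {z \<in> V. \<exists>a\<in>A. {a, z} \<in> E}"

text \<open>The index counts the vertices of a walk, not its edges: \<open>reach V E x j\<close> is
  the ball of radius \<open>j - 1\<close>, empty for \<open>j = 0\<close>. The ball
  \<open>B x\<close> is thus \<open>reach V E x (Suc i)\<close>, and the indices \<open>j\<close>,
  \<open>Suc j\<close> describe a breadth-first search from its very start.\<close>

primrec reach :: "'a set \<Rightarrow> 'a set set \<Rightarrow> 'a \<Rightarrow> nat \<Rightarrow> 'a set" where
  "reach V E x 0 = {}"
| "reach V E x (Suc j) = insert x (reach V E x j \<union> nbrs V E (reach V E x j))"

lemma reach_1: "reach V E x (Suc 0) = {x}"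
  by (simp add: nbrs_def)

lemma reach_subset: "x \<in> V \<Longrightarrow> reach V E x j \<subseteq> V"
  by (induction j) (auto simp: nbrs_def)

lemma reach_mono: "j \<le> k \<Longrightarrow> reach V E x j \<subseteq> reach V E x k"
  by (rule lift_Suc_mono_le[of "reach V E x"]) auto

lemma self_in_reach: "x \<in> reach V E x (Suc j)"
  by simp

lemma reach_step: "a \<in> reach V E x j \<Longrightarrow> {a, z} \<in> E \<Longrightarrow> z \<in> V \<Longrightarrow> z \<in> reach V E x (Suc j)"
  by (auto simp: nbrs_def)

lemma walk_snoc:
  "walk V E (xs @ [y]) \<longleftrightarrow> y \<in> V \<and> (xs = [] \<or> (walk V E xs \<and> {last xs, y} \<in> E))"
  by (auto simp: walk_def successively_append_iff)

lemma walk_rev: "walk V E (rev xs) \<longleftrightarrow> walk V E xs"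
  by (simp add: walk_def insert_commute)

lemma walk_imp_reach: "walk V E xs \<Longrightarrow> last xs \<in> reach V E (hd xs) (length xs)"
proof (induction xs rule: rev_induct)
  case (snoc y xs)
  show ?case
  proof (cases "xs = []")
    case False
    then have "last xs \<in> reach V E (hd xs) (length xs)" "{last xs, y} \<in> E" "y \<in> V"
      using snoc by (auto simp: walk_snoc)
    then show ?thesis using False reach_step by fastforce
  qed simp
qed (simp add: walk_def)

lemma reach_imp_walk:
  assumes "x \<in> V" "y \<in> reach V E x j"
  shows "\<exists>xs. walk V E xs \<and> hd xs = x \<and> last xs = y \<and> length xs \<le> j"
  using assms(2)
proof (induction j arbitrary: y)
  case (Suc j)
  consider "y = x" | "y \<in> reach V E x j" | a where "a \<in> reach V E x j" "{a, y} \<in> E" "y \<in> V"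
    using Suc.prems by (auto simp: nbrs_def)
  then show ?case
  proof cases
    case 1
    then show ?thesis using assms(1) by (intro exI[of _ "[x]"]) (auto simp: walk_def)
  next
    case 2
    then show ?thesis using Suc.IH le_SucI by blast
  next
    case 3
    then obtain xs where "walk V E xs" "hd xs = x" "last xs = a" "length xs \<le> j"
      using Suc.IH by blast
    moreover from this(1) have "xs \<noteq> []" by (simp add: walk_def)
    ultimately show ?thesis using 3
      by (intro exI[of _ "xs @ [y]"]) (auto simp: walk_snoc)
  qed
qed simp

lemma reach_sym:
  assumes "x \<in> V" "y \<in> V"
  shows "y \<in> reach V E x j \<longleftrightarrow> x \<in> reach V E y j"
proof -
  have "x \<in> reach V E y j" if x: "x \<in> V" and y: "y \<in> reach V E x j" for x y
  proof -
    obtain xs where xs: "walk V E xs" "hd xs = x" "last xs = y" "length xs \<le> j"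
      using reach_imp_walk[OF x y] by blast
    then have "xs \<noteq> []" by (simp add: walk_def)
    then have "x \<in> reach V E y (length xs)"
      using walk_imp_reach[of V E "rev xs"] xs by (simp add: walk_rev hd_rev last_rev)
    then show ?thesis by (rule subsetD[OF reach_mono[OF xs(4)]])
  qed
  then show ?thesis using assms by blast
qed

lemma gdist_le_iff:
  assumes "x \<in> V"
  shows "gdist V E x y \<le> enat j \<longleftrightarrow> y \<in> reach V E x (Suc j)"
proof
  assume "y \<in> reach V E x (Suc j)"
  then obtain xs where "walk V E xs" "hd xs = x" "last xs = y" "length xs \<le> Suc j"
    using reach_imp_walk[OF assms] by blast
  then show "gdist V E x y \<le> enat j"
    unfolding gdist_def by (intro INF_lower2[of xs]) auto
next
  assume le: "gdist V E x y \<le> enat j"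
  show "y \<in> reach V E x (Suc j)"
  proof (rule ccontr)
    assume not: "y \<notin> reach V E x (Suc j)"
    have "enat (Suc j) \<le> gdist V E x y"
      unfolding gdist_def
    proof (rule INF_greatest, simp, elim conjE)
      fix xs assume xs: "walk V E xs" "hd xs = x" "last xs = y"
      then have "y \<in> reach V E x (length xs)" using walk_imp_reach by metis
      then have "\<not> length xs \<le> Suc j" using not subsetD[OF reach_mono] by metis
      then show "Suc j \<le> length xs - Suc 0" by simp
    qed
    then show False using le by (metis Suc_n_not_le_n enat_ord_simps(1) order_trans)
  qed
qed

text \<open>Membership in balls of a common radius decides a comparison of distances, even if one of
  them is infinite. This is how ball counts become eliminated candidates.\<close>

lemma gdist_less:
  assumes "u \<in> V" "v \<in> V" "x \<in> reach V E u (Suc j)" "x \<notin> reach V E v (Suc j)"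
  shows "gdist V E u x < gdist V E v x"
  using assms gdist_le_iff[of u V E x j] gdist_le_iff[of v V E x j] by auto

text \<open>A potential that loses at least 1 whichever endpoint is the reply, and is positive while
  two candidates remain, bounds the number of queries. The edge may be chosen from the current
  candidate set alone.\<close>

lemma eq_num_le_potential:
  fixes \<psi> :: "nat \<Rightarrow> real"
  assumes fin: "finite V"
    and step: "\<And>W. W \<subseteq> V \<Longrightarrow> 2 \<le> card W \<Longrightarrow>
      \<exists>e\<in>E. \<forall>w\<in>e. \<psi> (card {x \<in> W. \<forall>y\<in>e. gdist V E w x \<le> gdist V E y x}) \<le> \<psi> (card W) - 1"
    and pos: "\<And>m. 2 \<le> m \<Longrightarrow> 0 < \<psi> m"
    and t: "\<psi> (card V) \<le> real t"
  shows "eq_num V E \<le> enat t"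
proof -
  define ok where "ok = (\<lambda>W e. e \<in> E \<and>
    (\<forall>w\<in>e. \<psi> (card {x \<in> W. \<forall>y\<in>e. gdist V E w x \<le> gdist V E y x}) \<le> \<psi> (card W) - 1))"
  define query where "query = (\<lambda>W. SOME e. ok W e)"
  \<comment> \<open>\<open>candidates\<close> refers to the algorithm, whose queries in turn depend
    on the candidates. Folding \<open>query\<close> over the history defines the sets first and the
    algorithm from them.\<close>
  define cand where "cand = (\<lambda>h. foldr
    (\<lambda>w W. {x \<in> W. w \<in> query W \<and> (\<forall>y \<in> query W. gdist V E w x \<le> gdist V E y x)}) h V)"
  define alg where "alg = (\<lambda>h. query (cand h))"
  have cand: "candidates V E alg h = cand h" for h
    by (induction h) (simp_all add: cand_def alg_def)
  have ok: "ok W (query W)" if "W \<subseteq> V" "2 \<le> card W" for W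
  proof -
    have "\<exists>e. ok W e" using step[OF that] unfolding ok_def Bex_def .
    then show ?thesis unfolding query_def by (rule someI_ex)
  qed
  have sub: "cand h \<subseteq> V" for h
    by (induction h) (auto simp: cand_def)
  have inv: "real (length h) + \<psi> (card (cand h)) \<le> \<psi> (card V)"
    if "2 \<le> card (cand h)" for h
    using that
  proof (induction h)
    case (Cons w h)
    have Cons_eq: "cand (w # h) = {x \<in> cand h. w \<in> query (cand h) \<and>
        (\<forall>y \<in> query (cand h). gdist V E w x \<le> gdist V E y x)}"
      by (simp add: cand_def)
    have finh: "finite (cand h)" using sub fin finite_subset by blast
    have subh: "cand (w # h) \<subseteq> cand h" unfolding Cons_eq by blast
    have 2: "2 \<le> card (cand h)" using card_mono[OF finh subh] Cons.prems by linarith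
    \<comment> \<open>A reply outside the queried edge empties the set, so surviving candidates
      certify a legal reply.\<close>
    have "cand (w # h) \<noteq> {}" using Cons.prems by (metis card.empty not_numeral_le_zero)
    then have w: "w \<in> query (cand h)" using Cons_eq by blast
    then have eq: "cand (w # h) =
        {x \<in> cand h. \<forall>y \<in> query (cand h). gdist V E w x \<le> gdist V E y x}"
      unfolding Cons_eq by blast
    have "\<psi> (card (cand (w # h))) \<le> \<psi> (card (cand h)) - 1"
      using ok[OF sub 2] w unfolding ok_def eq by blast
    moreover have "real (length h) + \<psi> (card (cand h)) \<le> \<psi> (card V)"
      using 2 by (rule Cons.IH)
    ultimately show ?case by simp
  qed (simp add: cand_def)
  have "locates_within V E alg t"
    unfolding locates_within_def cand
  proof (intro ballI allI impI)
    fix x h assume x: "x \<in> cand h"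
    show "card (cand h) = 1 \<or> alg h \<in> E \<and> length h < t"
    proof (cases "card (cand h) = 1")
      case False
      have "card (cand h) \<noteq> 0" using x sub fin by (metis card_0_eq empty_iff finite_subset)
      then have 2: "2 \<le> card (cand h)" using False by linarith
      have "real (length h) < real t" using inv[OF 2] pos[OF 2] t by linarith
      then show ?thesis using ok[OF sub 2] by (simp add: ok_def alg_def)
    qed simp
  qed
  then show ?thesis unfolding eq_num_def by (intro Inf_lower) blast
qed

text \<open>Reply \<open>w\<close> discards exactly the candidates strictly closer to the other
  endpoint; ties survive either reply, hence the strict inequalities.\<close>

lemma card_answer_le:
  assumes fin: "finite W" and uv: "w \<in> {u, v}"
    and "q \<le> real (card {x \<in> W. gdist V E u x < gdist V E v x})"
    and "q \<le> real (card {x \<in> W. gdist V E v x < gdist V E u x})"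
  shows "real (card {x \<in> W. \<forall>y\<in>{u, v}. gdist V E w x \<le> gdist V E y x}) \<le> real (card W) - q"
proof -
  obtain w' where w': "{u, v} = {w, w'}" "q \<le> real (card {x \<in> W. gdist V E w' x < gdist V E w x})"
    using assms by auto
  have "card {x \<in> W. \<forall>y\<in>{u, v}. gdist V E w x \<le> gdist V E y x} \<le>
      card (W - {x \<in> W. gdist V E w' x < gdist V E w x})"
    using fin w'(1) by (intro card_mono) (auto simp: doubleton_eq_iff)
  also have "\<dots> = card W - card {x \<in> W. gdist V E w' x < gdist V E w x}"
    using fin by (intro card_Diff_subset) auto
  finally show ?thesis
    using w'(2) card_mono[OF fin, of "{x \<in> W. gdist V E w' x < gdist V E w x}"] by simp
qed

lemma ln_step:
  fixes q :: real
  assumes "0 < q" "0 < w" "0 < w'" "w' \<le> w - q * w"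
  shows "ln w' / q \<le> ln w / q - 1"
proof -
  have "w * (1 - q) = w - q * w" by (simp add: algebra_simps)
  then have w': "w' \<le> w * (1 - q)" using assms(4) by simp
  then have "0 < w * (1 - q)" using assms(3) by linarith
  then have q: "0 < 1 - q" using assms(2) by (rule zero_less_mult_pos)
  have "ln w' \<le> ln (w * (1 - q))" using w' assms(3) by simp
  also have "\<dots> = ln w + ln (1 - q)" using assms(2) q by (simp add: ln_mult)
  also have "\<dots> \<le> ln w - q" using ln_add_one_self_le_self2[of "- q"] q by simp
  finally show ?thesis using assms(1) by (simp add: field_simps)
qed

lemma eq_num_le_two_phases:
  assumes fin: "finite V" and q: "0 < q" and k0: "1 \<le> k0" "k0 \<le> real (card V)"
    and large: "\<And>W. W \<subseteq> V \<Longrightarrow> k0 \<le> real (card W) \<Longrightarrow>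
      \<exists>u v. {u, v} \<in> E \<and> q * real (card W) \<le> real (card {x \<in> W. gdist V E u x < gdist V E v x})
        \<and> q * real (card W) \<le> real (card {x \<in> W. gdist V E v x < gdist V E u x})"
    and small: "\<And>W. W \<subseteq> V \<Longrightarrow> 2 \<le> card W \<Longrightarrow>
      \<exists>u v. {u, v} \<in> E \<and> 1 \<le> card {x \<in> W. gdist V E u x < gdist V E v x}
        \<and> 1 \<le> card {x \<in> W. gdist V E v x < gdist V E u x}"
    and t: "ln (real (card V) / k0) / q + k0 + 1 \<le> real t"
  shows "eq_num V E \<le> enat t"
proof -
  \<comment> \<open>Above \<open>k0\<close> one query shrinks the set by a factor
    \<open>1 - q\<close>, worth \<open>q\<close> in the logarithm; below, each query removes one
    candidate. The offset \<open>k0 + 1\<close> makes the step across the threshold lose at least 1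
    as well.\<close>
  define \<psi> :: "nat \<Rightarrow> real"
    where "\<psi> = (\<lambda>w. if real w < k0 then real w else ln (real w / k0) / q + k0 + 1)"
  have drop: "\<psi> w' \<le> \<psi> w - 1" if w: "k0 \<le> real w" "real w' \<le> real w - q * real w" for w w'
  proof (cases "real w' < k0")
    case True
    have "0 \<le> ln (real w / k0) / q" using w k0 q by simp
    then show ?thesis using True w by (simp add: \<psi>_def)
  next
    case False
    have "ln (real w') / q \<le> ln (real w) / q - 1"
      using w q k0 False by (intro ln_step) auto
    then show ?thesis using False w k0 by (simp add: \<psi>_def ln_div diff_divide_distrib)
  qed
  have drop_small: "\<psi> w' \<le> \<psi> w - 1" if "real w < k0" "real w' \<le> real w - 1" for w w'
    using that by (auto simp: \<psi>_def)
  show ?thesis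
  proof (rule eq_num_le_potential[OF fin, of E \<psi>])
    fix W assume W: "W \<subseteq> V" "2 \<le> card W"
    then have finW: "finite W" using fin finite_subset by blast
    show "\<exists>e\<in>E. \<forall>w\<in>e. \<psi> (card {x \<in> W. \<forall>y\<in>e. gdist V E w x \<le> gdist V E y x}) \<le> \<psi> (card W) - 1"
    proof (cases "real (card W) < k0")
      case True
      obtain u v where uv: "{u, v} \<in> E" "1 \<le> card {x \<in> W. gdist V E u x < gdist V E v x}"
        "1 \<le> card {x \<in> W. gdist V E v x < gdist V E u x}"
        using small[OF W] by blast
      have "\<forall>w\<in>{u, v}. \<psi> (card {x \<in> W. \<forall>y\<in>{u, v}. gdist V E w x \<le> gdist V E y x}) \<le> \<psi> (card W) - 1"
      proof
        fix w assume "w \<in> {u, v}"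
        then have "real (card {x \<in> W. \<forall>y\<in>{u, v}. gdist V E w x \<le> gdist V E y x}) \<le> real (card W) - 1"
          using uv(2,3) by (intro card_answer_le[OF finW]) linarith+
        then show "\<psi> (card {x \<in> W. \<forall>y\<in>{u, v}. gdist V E w x \<le> gdist V E y x}) \<le> \<psi> (card W) - 1"
          by (rule drop_small[OF True])
      qed
      then show ?thesis using uv(1) by (rule bexI)
    next
      case False
      obtain u v where uv: "{u, v} \<in> E"
        "q * real (card W) \<le> real (card {x \<in> W. gdist V E u x < gdist V E v x})"
        "q * real (card W) \<le> real (card {x \<in> W. gdist V E v x < gdist V E u x})"
        using large[OF W(1)] False by fastforce
      have "\<forall>w\<in>{u, v}. \<psi> (card {x \<in> W. \<forall>y\<in>{u, v}. gdist V E w x \<le> gdist V E y x}) \<le> \<psi> (card W) - 1"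
        using False by (intro ballI drop card_answer_le[OF finW _ uv(2,3)]) linarith+
      then show ?thesis using uv(1) by (rule bexI)
    qed
  next
    show "0 < \<psi> m" if "2 \<le> m" for m
    proof (cases "real m < k0")
      case False
      then have "0 \<le> ln (real m / k0) / q" using k0 q by simp
      then show ?thesis using False k0 by (simp add: \<psi>_def)
    qed (use that in \<open>simp add: \<psi>_def\<close>)
  next
    show "\<psi> (card V) \<le> real t" using k0 t by (simp add: \<psi>_def)
  qed
qed

lemma card_ge_1I: "finite W \<Longrightarrow> x \<in> W \<Longrightarrow> P x \<Longrightarrow> 1 \<le> card {x \<in> W. P x}"
  unfolding One_nat_def Suc_le_eq card_gt_0_iff by auto

lemma separating_edge:
  assumes fin: "finite W" and WV: "W \<subseteq> V" and two: "2 \<le> card W"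
    and conn: "\<And>x y. x \<in> V \<Longrightarrow> y \<in> V \<Longrightarrow> \<exists>j. x \<in> reach V E y j"
  shows "\<exists>u v. {u, v} \<in> E \<and> 1 \<le> card {x \<in> W. gdist V E u x < gdist V E v x}
        \<and> 1 \<le> card {x \<in> W. gdist V E v x < gdist V E u x}"
proof -
  obtain x y where xy: "x \<in> W" "y \<in> W" "x \<noteq> y"
    using two card_le_Suc0_iff_eq[OF fin] by fastforce
  then have V: "x \<in> V" "y \<in> V" using WV by auto
  \<comment> \<open>\<open>m\<close> is the distance plus one, because \<open>reach\<close> is empty
    at index 0; as \<open>x \<noteq> y\<close>, it is at least 2. The vertex \<open>v\<close> below
    precedes \<open>x\<close> on a shortest path from \<open>y\<close>.\<close>
  define m where "m = (LEAST j. x \<in> reach V E y j)"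
  have m: "x \<in> reach V E y m" and least: "\<And>j. j < m \<Longrightarrow> x \<notin> reach V E y j"
    using conn[OF V] unfolding m_def by (auto intro: LeastI_ex dest: not_less_Least)
  obtain m1 where m1: "m = Suc m1" using m by (cases m) auto
  obtain m2 where m2: "m1 = Suc m2" using m xy(3) m1 by (cases m1) (auto simp: nbrs_def)
  obtain v where v: "v \<in> reach V E y m1" "{v, x} \<in> E"
    using m least[of m1] xy(3) unfolding m1 by (auto simp: nbrs_def)
  have vV: "v \<in> V" using v(1) reach_subset[OF V(2)] by blast
  have "gdist V E v y < gdist V E x y"
    using gdist_less[OF vV V(1), of y E m2] v(1) least[of m1] vV V
    by (auto simp: m1 m2 reach_sym[of _ V] simp del: reach.simps)
  moreover have "v \<noteq> x" using v(1) least[of m1] m1 by auto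
  then have "gdist V E x x < gdist V E v x"
    using gdist_less[OF V(1) vV, of x E 0] by (auto simp: reach_1 simp del: reach.simps)
  ultimately show ?thesis using v(2) xy fin
    by (intro exI[of _ v] exI[of _ x] conjI card_ge_1I) auto
qed

section \<open>Splitting a large candidate set\<close>

lemma sum_card_swap:
  assumes "finite A" "finite B"
  shows "(\<Sum>a\<in>A. card {b \<in> B. R a b}) = (\<Sum>b\<in>B. card {a \<in> A. R a b})"
proof -
  have "(\<Sum>a\<in>A. card {b \<in> B. R a b}) = (\<Sum>a\<in>A. \<Sum>b\<in>B. if R a b then 1 else 0)"
    using assms by (simp add: sum.If_cases Int_def)
  also have "\<dots> = (\<Sum>b\<in>B. \<Sum>a\<in>A. if R a b then 1 else 0)" by (rule sum.swap)
  also have "\<dots> = (\<Sum>b\<in>B. card {a \<in> A. R a b})"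
    using assms by (simp add: sum.If_cases Int_def)
  finally show ?thesis .
qed

text \<open>With \<open>\<mu> = |W| D / n\<close>, the second moment of \<open>u \<mapsto> |W \<inter> B u|\<close> leaves at least half of the
  vertices \<open>u\<close> with \<open>|W \<inter> B u| \<ge> 7\<mu>/8\<close>. The average of \<open>|W \<inter> B u \<inter> B v|\<close> over the edges is so
  small that some edge \<open>{u, v}\<close> inside this half has \<open>|W \<inter> B u \<inter> B v| < \<mu>/8\<close>.\<close>

lemma balanced_edge:
  fixes V :: "'a set" and B :: "'a \<Rightarrow> 'a set" and D d :: real
  defines "n \<equiv> real (card V)"
  assumes fin: "finite V" and V: "V \<noteq> {}" and W: "W \<subseteq> V" and E: "finite E"
    and sub: "\<And>x. x \<in> V \<Longrightarrow> B x \<subseteq> V"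
    and sym: "\<And>x y. x \<in> V \<Longrightarrow> y \<in> V \<Longrightarrow> y \<in> B x \<longleftrightarrow> x \<in> B y"
    and D: "0 < D" and d: "0 < d"
    and lower: "\<And>x. x \<in> V \<Longrightarrow> (1 - 1/512) * D \<le> real (card (B x))"
    and upper: "\<And>x. x \<in> V \<Longrightarrow> real (card (B x)) \<le> 4 * D"
    and codeg: "\<And>x y. x \<in> V \<Longrightarrow> y \<in> V \<Longrightarrow> x \<noteq> y \<Longrightarrow> real (card (B x \<inter> B y)) \<le> (1 + 1/512) * D\<^sup>2 / n"
    and dense: "\<And>U. U \<subseteq> V \<Longrightarrow> n \<le> 2 * real (card U) \<Longrightarrow> n * d / 20 \<le> real (card {e \<in> E. e \<subseteq> U})"
    and sparse: "\<And>x. x \<in> V \<Longrightarrow> real (card {e \<in> E. e \<subseteq> B x}) \<le> D * d / 400"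
    and edges: "\<And>e. e \<in> E \<Longrightarrow> \<exists>u v. e = {u, v} \<and> u \<in> V \<and> v \<in> V"
    and large: "2048 * n \<le> real (card W) * D"
  shows "\<exists>u v. {u, v} \<in> E \<and> u \<in> V \<and> v \<in> V \<and> 3/4 * D / n * real (card W) \<le> real (card (W \<inter> B u - B v))
    \<and> 3/4 * D / n * real (card W) \<le> real (card (W \<inter> B v - B u))"
proof -
  define k where "k = real (card W)"
  define \<mu> where "\<mu> = k * D / n"
  define g where "g = (\<lambda>u. real (card (W \<inter> B u)))"
  have finW: "finite W" using W fin finite_subset by blast
  have finB: "finite (B x)" if "x \<in> V" for x using sub[OF that] fin finite_subset by blast
  have n: "0 < n" using fin V by (simp add: n_def card_gt_0_iff)
  have k: "0 \<le> k" by (simp add: k_def)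
  have \<mu>: "2048 \<le> \<mu>" using large n by (simp add: \<mu>_def k_def field_simps)
  have kD: "k * D = n * \<mu>" using n by (simp add: \<mu>_def)
  have g_eq: "g u = real (card {x \<in> W. u \<in> B x})" if "u \<in> V" for u
  proof -
    have "W \<inter> B u = {x \<in> W. u \<in> B x}" using sym that W by blast
    then show ?thesis by (simp add: g_def)
  qed
  have sum_g: "(\<Sum>u\<in>V. g u) = (\<Sum>x\<in>W. real (card (B x)))"
  proof -
    have "(\<Sum>u\<in>V. card {x \<in> W. u \<in> B x}) = (\<Sum>x\<in>W. card {u \<in> V. u \<in> B x})"
      by (rule sum_card_swap[OF fin finW])
    also have "\<dots> = (\<Sum>x\<in>W. card (B x))"
    proof (rule sum.cong[OF refl])
      fix x assume "x \<in> W"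
      then have "{u \<in> V. u \<in> B x} = B x" using sub W by blast
      then show "card {u \<in> V. u \<in> B x} = card (B x)" by simp
    qed
    finally show ?thesis using g_eq by (simp flip: of_nat_sum)
  qed
  have "(\<Sum>x\<in>W. (1 - 1/512) * D) \<le> (\<Sum>u\<in>V. g u)"
    unfolding sum_g using lower W by (intro sum_mono) blast
  then have first: "511/512 * (n * \<mu>) \<le> (\<Sum>u\<in>V. g u)"
    by (simp add: k_def[symmetric] kD[symmetric])
  have sum_g2: "(\<Sum>u\<in>V. (g u)\<^sup>2) = (\<Sum>z\<in>W \<times> W. real (card (B (fst z) \<inter> B (snd z))))"
  proof -
    have "(\<Sum>u\<in>V. (g u)\<^sup>2) = (\<Sum>u\<in>V. real (card {z \<in> W \<times> W. u \<in> B (fst z) \<inter> B (snd z)}))"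
    proof (rule sum.cong[OF refl])
      fix u assume u: "u \<in> V"
      have "{z \<in> W \<times> W. u \<in> B (fst z) \<inter> B (snd z)} = {x \<in> W. u \<in> B x} \<times> {x \<in> W. u \<in> B x}"
        by auto
      then show "(g u)\<^sup>2 = real (card {z \<in> W \<times> W. u \<in> B (fst z) \<inter> B (snd z)})"
        using g_eq[OF u] by (simp add: card_cartesian_product power2_eq_square)
    qed
    also have "\<dots> = real (\<Sum>z\<in>W \<times> W. card {u \<in> V. u \<in> B (fst z) \<inter> B (snd z)})"
      using sum_card_swap[of V "W \<times> W" "\<lambda>u z. u \<in> B (fst z) \<inter> B (snd z)"] fin finW
      by (simp flip: of_nat_sum)
    also have "(\<Sum>z\<in>W \<times> W. card {u \<in> V. u \<in> B (fst z) \<inter> B (snd z)}) =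
        (\<Sum>z\<in>W \<times> W. card (B (fst z) \<inter> B (snd z)))"
    proof (rule sum.cong[OF refl])
      fix z assume "z \<in> W \<times> W"
      then have "{u \<in> V. u \<in> B (fst z) \<inter> B (snd z)} = B (fst z) \<inter> B (snd z)" using sub W by fastforce
      then show "card {u \<in> V. u \<in> B (fst z) \<inter> B (snd z)} = card (B (fst z) \<inter> B (snd z))" by simp
    qed
    finally show ?thesis by simp
  qed
  \<comment> \<open>The codegree bound says nothing about pairs \<open>x = y\<close>. They are
    charged a full ball, \<open>4 * D\<close>, by the \<open>if\<close> term.\<close>
  have "(\<Sum>u\<in>V. (g u)\<^sup>2) \<le>
      (\<Sum>z\<in>W \<times> W. (if fst z = snd z then 4 * D else 0) + (1 + 1/512) * D\<^sup>2 / n)"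
    unfolding sum_g2
  proof (rule sum_mono)
    fix z assume z: "z \<in> W \<times> W"
    have pos: "0 \<le> (1 + 1/512) * D\<^sup>2 / n" using n by simp
    show "real (card (B (fst z) \<inter> B (snd z))) \<le>
        (if fst z = snd z then 4 * D else 0) + (1 + 1/512) * D\<^sup>2 / n"
    proof (cases "fst z = snd z")
      case True
      then have "real (card (B (fst z) \<inter> B (snd z))) \<le> 4 * D" using upper z W by auto
      then show ?thesis using True pos by simp
    next
      case False
      have "fst z \<in> V" "snd z \<in> V" using z W by auto
      then have "real (card (B (fst z) \<inter> B (snd z))) \<le> (1 + 1/512) * D\<^sup>2 / n"
        using False by (rule codeg)
      then show ?thesis using False by simp
    qed
  qed
  also have "\<dots> = 4 * (k * D) + 513/512 * (n * \<mu>\<^sup>2)"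
  proof -
    have "W \<times> W \<inter> {z. fst z = snd z} = (\<lambda>x. (x, x)) ` W" by auto
    then have "card (W \<times> W \<inter> {z. fst z = snd z}) = card W"
      by (simp add: card_image inj_on_def)
    then have "(\<Sum>z\<in>W \<times> W. (if fst z = snd z then 4 * D else 0) + c) = 4 * (k * D) + k * k * c" for c
      using finW by (simp add: sum.distrib sum.If_cases card_cartesian_product k_def)
    moreover have "k * k * ((1 + 1/512) * D\<^sup>2 / n) = 513/512 * (n * \<mu>\<^sup>2)"
      using n by (simp add: \<mu>_def field_simps power2_eq_square)
    ultimately show ?thesis by simp
  qed
  finally have second: "(\<Sum>u\<in>V. (g u)\<^sup>2) \<le> 4 * (n * \<mu>) + 513/512 * (n * \<mu>\<^sup>2)" by (simp only: kD)
  define U where "U = {u \<in> V. 7/8 * \<mu> \<le> g u}"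
  have UV: "U \<subseteq> V" by (auto simp: U_def)
  have finU: "finite U" using UV fin finite_subset by blast
  \<comment> \<open>Chebyshev around \<open>\<mu>\<close>: each vertex missing from \<open>U\<close>
    deviates by more than \<open>\<mu> / 8\<close>.\<close>
  have "(\<Sum>u\<in>V - U. \<mu>\<^sup>2 / 64) \<le> (\<Sum>u\<in>V - U. (g u - \<mu>)\<^sup>2)"
  proof (rule sum_mono)
    fix u assume "u \<in> V - U"
    then have "(\<mu> / 8)\<^sup>2 \<le> (\<mu> - g u)\<^sup>2" using \<mu> by (intro power_mono) (auto simp: U_def)
    then show "\<mu>\<^sup>2 / 64 \<le> (g u - \<mu>)\<^sup>2" by (simp add: power_divide power2_commute)
  qed
  also have "\<dots> \<le> (\<Sum>u\<in>V. (g u - \<mu>)\<^sup>2)" using fin by (intro sum_mono2) auto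
  also have "\<dots> = (\<Sum>u\<in>V. (g u)\<^sup>2) - 2 * \<mu> * (\<Sum>u\<in>V. g u) + n * \<mu>\<^sup>2"
  proof -
    have "(g u - \<mu>)\<^sup>2 = (g u)\<^sup>2 - (2 * \<mu>) * g u + \<mu>\<^sup>2" for u by (simp add: power2_diff)
    then show ?thesis
      by (simp only: sum.distrib sum_subtractf sum_distrib_left[symmetric]) (simp add: n_def)
  qed
  also have "\<dots> \<le> 4 * (n * \<mu>) + 513/512 * (n * \<mu>\<^sup>2) - 2 * \<mu> * (511/512 * (n * \<mu>)) + n * \<mu>\<^sup>2"
    using second first \<mu> by (intro add_right_mono diff_mono mult_left_mono) auto
  also have "\<dots> = 4 * (n * \<mu>) + 3/512 * (n * \<mu>\<^sup>2)" by (simp add: power2_eq_square)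
  \<comment> \<open>Here \<open>\<mu> \<ge> 2048\<close> pays for the diagonal:
    \<open>4 \<mu> \<le> \<mu>^2 / 512\<close>. The coefficient \<open>4/512\<close> is half of
    \<open>1/64\<close>, which leaves at most \<open>n / 2\<close> vertices outside
    \<open>U\<close>; the tolerances \<open>1/512\<close> are chosen to fit.\<close>
  also have "\<dots> \<le> 4/512 * (n * \<mu>\<^sup>2)"
  proof -
    have "2048 * (n * \<mu>) \<le> \<mu> * (n * \<mu>)" using \<mu> n by (intro mult_right_mono) auto
    then show ?thesis by (simp add: power2_eq_square algebra_simps)
  qed
  finally have "real (card (V - U)) * \<mu>\<^sup>2 \<le> n / 2 * \<mu>\<^sup>2" by simp
  then have "real (card (V - U)) \<le> n / 2" using \<mu> by (subst (asm) mult_le_cancel_right) auto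
  moreover have "real (card (V - U)) = n - real (card U)"
    using card_Diff_subset[OF finU UV] card_mono[OF fin UV] by (simp add: n_def of_nat_diff)
  ultimately have "n \<le> 2 * real (card U)" by simp
  then have EU: "n * d / 20 \<le> real (card {e \<in> E. e \<subseteq> U})" by (rule dense[OF UV])
  \<comment> \<open>By symmetry \<open>e \<subseteq> B x\<close> says that \<open>x\<close> lies in
    the balls of both ends of \<open>e\<close>. Counting these incidences by \<open>x\<close> bounds
    them by the edges inside the balls, so at most \<open>n * d / 50\<close> edges are bad, fewer
    than the \<open>n * d / 20\<close> inside \<open>U\<close>.\<close>
  define F where "F = {e \<in> E. \<mu> / 8 \<le> real (card {x \<in> W. e \<subseteq> B x})}"
  have "real (card F) * (\<mu> / 8) = (\<Sum>e\<in>F. \<mu> / 8)" by simp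
  also have "\<dots> \<le> (\<Sum>e\<in>F. real (card {x \<in> W. e \<subseteq> B x}))" by (intro sum_mono) (simp add: F_def)
  also have "\<dots> \<le> (\<Sum>e\<in>E. real (card {x \<in> W. e \<subseteq> B x}))"
    using E by (intro sum_mono2) (auto simp: F_def)
  also have "\<dots> = (\<Sum>x\<in>W. real (card {e \<in> E. e \<subseteq> B x}))"
    using sum_card_swap[OF E finW, of "\<lambda>e x. e \<subseteq> B x"] by (simp flip: of_nat_sum)
  also have "\<dots> \<le> (\<Sum>x\<in>W. D * d / 400)" using sparse W by (intro sum_mono) blast
  also have "\<dots> = (k * D) * d / 400" by (simp add: k_def)
  also have "\<dots> = n * d / 50 * (\<mu> / 8)" by (simp add: kD)
  finally have "real (card F) \<le> n * d / 50" using \<mu> by (subst (asm) mult_le_cancel_right) auto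
  moreover have "n * d / 50 < n * d / 20" using n d by simp
  ultimately have "card F < card {e \<in> E. e \<subseteq> U}" using EU by linarith
  then have "\<not> {e \<in> E. e \<subseteq> U} \<subseteq> F" using E card_mono[of F] by (auto simp: F_def not_le[symmetric])
  then obtain e where e: "e \<in> E" "e \<subseteq> U" "e \<notin> F" by blast
  then obtain u v where uv: "e = {u, v}" "u \<in> V" "v \<in> V" using edges by blast
  have few: "real (card {x \<in> W. {u, v} \<subseteq> B x}) < \<mu> / 8" using e uv(1) by (auto simp: F_def)
  have key: "3/4 * \<mu> \<le> real (card (W \<inter> B a - B b))" if ab: "{a, b} = {u, v}" for a b
  proof -
    have aV: "a \<in> V" "b \<in> V" "a \<in> U" using ab uv e by (auto simp: doubleton_eq_iff)
    have "W \<inter> B a \<inter> B b = {x \<in> W. {u, v} \<subseteq> B x}"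
      unfolding ab[symmetric] using sym aV W by blast
    then have "real (card (W \<inter> B a \<inter> B b)) < \<mu> / 8" using few by simp
    moreover have "7/8 * \<mu> \<le> real (card (W \<inter> B a))" using aV(3) by (simp add: U_def g_def)
    moreover have "card (W \<inter> B a) = card (W \<inter> B a - B b) + card (W \<inter> B a \<inter> B b)"
    proof -
      have "card ((W \<inter> B a - B b) \<union> (W \<inter> B a \<inter> B b)) = card (W \<inter> B a - B b) + card (W \<inter> B a \<inter> B b)"
        using finW by (intro card_Un_disjoint) auto
      moreover have "(W \<inter> B a - B b) \<union> (W \<inter> B a \<inter> B b) = W \<inter> B a" by blast
      ultimately show ?thesis by simp
    qed
    ultimately show ?thesis by simp
  qed
  have "3/4 * D / n * real (card W) = 3/4 * \<mu>" by (simp add: \<mu>_def k_def)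
  then show ?thesis using key[of u v] key[of v u] e(1) uv
    by (intro exI[of _ u] exI[of _ v]) (auto simp: insert_commute)
qed

section \<open>Breadth-first exploration of the random graph\<close>

lemma nbrs_cong:
  assumes "E \<inter> {e. e \<inter> A \<noteq> {}} = E' \<inter> {e. e \<inter> A \<noteq> {}}" "S \<subseteq> A"
  shows "nbrs V E S = nbrs V E' S"
proof -
  have "{a, z} \<in> E \<longleftrightarrow> {a, z} \<in> E'" if "a \<in> S" for a z
  proof -
    have "{a, z} \<in> {e. e \<inter> A \<noteq> {}}" using that assms(2) by blast
    then show ?thesis using assms(1) by (metis IntD1 IntI)
  qed
  then show ?thesis unfolding nbrs_def by blast
qed

text \<open>Advancing the search by one step inspects only edges that meet the current ball. Hence
  the agreement extends to index \<open>Suc j\<close>, one beyond the ball contained in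
  \<open>A\<close>.\<close>

lemma reach_cong:
  assumes "E \<inter> {e. e \<inter> A \<noteq> {}} = E' \<inter> {e. e \<inter> A \<noteq> {}}" "reach V E x j \<subseteq> A" "k \<le> Suc j"
  shows "reach V E x k = reach V E' x k"
  using assms(3)
proof (induction k)
  case (Suc k)
  then have "reach V E x k \<subseteq> A" using reach_mono[of k j V E x] assms(2) by auto
  then show ?case using Suc nbrs_cong[OF assms(1)] by simp
qed simp

text \<open>The event that the search is in state \<open>(A', A)\<close> leaves all edges between
  \<open>A - A'\<close> and \<open>V - A\<close> unread. The state is fixed because the set of
  inspected edges varies with it.\<close>

lemma depends_on_reach:
  "depends_on {e. e \<inter> A' \<noteq> {}} (\<lambda>E. (reach V E x j, reach V E x (Suc j)) = (A', A))"
proof -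
  have *: "(reach V E' x j, reach V E' x (Suc j)) = (A', A)"
    if eq: "E \<inter> {e. e \<inter> A' \<noteq> {}} = E' \<inter> {e. e \<inter> A' \<noteq> {}}"
      and s: "(reach V E x j, reach V E x (Suc j)) = (A', A)" for E E'
  proof -
    have "reach V E x j \<subseteq> A'" using s by simp
    then show ?thesis using reach_cong[OF eq, of V x j j] reach_cong[OF eq, of V x j "Suc j"] s
      by (simp del: reach.simps)
  qed
  show ?thesis
  proof (rule depends_onI)
    fix E E' assume "E \<inter> {e. e \<inter> A' \<noteq> {}} = E' \<inter> {e. e \<inter> A' \<noteq> {}}"
    then show "((reach V E x j, reach V E x (Suc j)) = (A', A)) =
        ((reach V E' x j, reach V E' x (Suc j)) = (A', A))"
      using *[of E E'] *[of E' E] by argo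
  qed
qed

text \<open>With the shifted index of \<open>reach\<close> this is the sphere of radius exactly
  \<open>j\<close>.\<close>

definition level :: "'a set \<Rightarrow> 'a set set \<Rightarrow> 'a \<Rightarrow> nat \<Rightarrow> 'a set" where
  "level V E x j = reach V E x (Suc j) - reach V E x j"

definition hit :: "'a set \<Rightarrow> 'a \<Rightarrow> 'a set set \<Rightarrow> bool" where
  "hit S z E \<longleftrightarrow> (\<exists>a\<in>S. {a, z} \<in> E)"

lemma level_0: "level V E x 0 = {x}"
  by (simp add: level_def reach_1 del: reach.simps(2))

text \<open>Neighbours of the inner ball are already reached, so only the last sphere contributes
  new vertices, and only through edges that the state has not revealed.\<close>

lemma level_Suc:
  "level V E x (Suc j) = {z \<in> V - reach V E x (Suc j). hit (level V E x j) z E}" if "x \<in> V"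
proof -
  have "z \<in> reach V E x (Suc j)" if "a \<in> reach V E x j" "{a, z} \<in> E" "z \<in> V" for a z
    using reach_step that by metis
  then show ?thesis
    using \<open>x \<in> V\<close> self_in_reach[of x V E j]
    unfolding level_def hit_def reach.simps(2)[of V E x "Suc j"] nbrs_def by blast
qed

lemma depends_on_hit: "depends_on ((\<lambda>a. {a, z}) ` S) (hit S z)"
proof (rule depends_onI)
  fix E E' assume eq: "E \<inter> (\<lambda>a. {a, z}) ` S = E' \<inter> (\<lambda>a. {a, z}) ` S"
  have "{a, z} \<in> E \<longleftrightarrow> {a, z} \<in> E'" if "a \<in> S" for a
    using eq that by (metis IntD1 IntI imageI)
  then show "hit S z E = hit S z E'" by (simp add: hit_def)
qed

definition all_edges :: "'a set \<Rightarrow> 'a set set" where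
  "all_edges V = {e. e \<subseteq> V \<and> card e = 2}"

abbreviation random_graph :: "'a set \<Rightarrow> real \<Rightarrow> 'a set set pmf" where
  "random_graph V p \<equiv> random_subset (all_edges V) p"

lemma finite_all_edges: "finite V \<Longrightarrow> finite (all_edges V)"
  by (rule finite_subset[of _ "Pow V"]) (auto simp: all_edges_def)

lemma pair_in_all_edges: "{a, z} \<in> all_edges V \<longleftrightarrow> a \<in> V \<and> z \<in> V \<and> a \<noteq> z"
  by (auto simp: all_edges_def card_insert_if)

text \<open>The vertices at which the two explorations meet for the first time in step \<open>j + 1\<close>. Removing the
  other ball from each sphere makes the two \<open>hit\<close> events depend on disjoint sets of unrevealed edges.\<close>

definition merge_set :: "'a set \<Rightarrow> 'a set set \<Rightarrow> 'a \<Rightarrow> 'a \<Rightarrow> nat \<Rightarrow> 'a set" where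
  "merge_set V E x y j = {z \<in> V - reach V E x (Suc j) - reach V E y (Suc j).
     hit (level V E x j - reach V E y (Suc j)) z E \<and> hit (level V E y j - reach V E x (Suc j)) z E}"

section \<open>Concentration of a single exploration step\<close>

context
  fixes V :: "'a set" and p :: real
  assumes fin: "finite V" and p: "0 \<le> p" "p \<le> 1"
begin

lemma prob_not_member: "e \<in> all_edges V \<Longrightarrow> measure_pmf.prob (random_graph V p) {E. e \<notin> E} = 1 - p"
proof -
  assume e: "e \<in> all_edges V"
  have "measure_pmf.prob (random_graph V p) {E. e \<notin> E} = 1 - measure_pmf.prob (random_graph V p) {E. e \<in> E}"
    using measure_pmf.prob_compl[of "{E. e \<in> E}" "random_graph V p"] by (simp add: Compl_eq_Diff_UNIV[symmetric] Collect_neg_eq)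
  then show ?thesis using prob_member_random_subset[OF finite_all_edges[OF fin] e p] by simp
qed

lemma prob_none:
  assumes "F \<subseteq> all_edges V"
  shows "measure_pmf.prob (random_graph V p) {E. \<forall>e\<in>F. e \<notin> E} = (1 - p) ^ card F"
proof -
  have "finite F" using assms finite_all_edges[OF fin] finite_subset by blast
  moreover have "depends_on {e} (\<lambda>E. e \<notin> E)" for e :: "'a set"
    by (rule depends_onI) blast
  ultimately have "measure_pmf.prob (random_graph V p) {E. \<forall>e\<in>F. e \<notin> E} = (\<Prod>e\<in>F. measure_pmf.prob (random_graph V p) {E. e \<notin> E})"
    by (intro prob_all_depends_on[OF finite_all_edges[OF fin], of F "\<lambda>e. {e}"])
      (auto simp: disjoint_family_on_def)
  also have "\<dots> = (\<Prod>e\<in>F. 1 - p)" using assms prob_not_member by (intro prod.cong refl) blast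
  finally show ?thesis by simp
qed

lemma prob_hit:
  assumes "S \<subseteq> V" "z \<in> V" "z \<notin> S"
  shows "measure_pmf.prob (random_graph V p) {E. hit S z E} = 1 - (1 - p) ^ card S"
proof -
  have "measure_pmf.prob (random_graph V p) {E. \<forall>e\<in>(\<lambda>a. {a, z}) ` S. e \<notin> E} = (1 - p) ^ card ((\<lambda>a. {a, z}) ` S)"
    using assms by (intro prob_none) (auto simp: pair_in_all_edges)
  moreover have "card ((\<lambda>a. {a, z}) ` S) = card S"
    by (intro card_image) (auto simp: inj_on_def doubleton_eq_iff)
  moreover have "{E. \<forall>e\<in>(\<lambda>a. {a, z}) ` S. e \<notin> E} = UNIV - {E. hit S z E}"
    by (auto simp: hit_def)
  ultimately show ?thesis using measure_pmf.prob_compl[of "{E. hit S z E}" "random_graph V p"] by simp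
qed

lemma prob_hit_le:
  assumes "S \<subseteq> V" "z \<in> V" "z \<notin> S"
  shows "measure_pmf.prob (random_graph V p) {E. hit S z E} \<le> p * real (card S)"
  using Bernoulli_inequality[of "- p" "card S"] p prob_hit[OF assms] by (simp add: mult.commute)

text \<open>The quadratic loss accounts for repeated hits. Relative to the main term it is
  \<open>p * card S\<close>, which for a sphere of radius \<open>j\<close> is of order
  \<open>d^(j+1) / n\<close>.\<close>

lemma prob_hit_ge:
  assumes "S \<subseteq> V" "z \<in> V" "z \<notin> S"
  shows "p * real (card S) - (p * real (card S))\<^sup>2 \<le> measure_pmf.prob (random_graph V p) {E. hit S z E}"
proof -
  have "(1 - p) ^ card S \<le> exp (- p) ^ card S"
    using p exp_ge_add_one_self[of "- p"] by (intro power_mono) auto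
  also have "\<dots> = exp (- (p * real (card S)))" by (simp add: exp_of_nat_mult[symmetric] mult.commute)
  also have "\<dots> \<le> 1 - p * real (card S) + (p * real (card S))\<^sup>2"
    using p by (intro exp_minus_le) simp
  finally show ?thesis using prob_hit[OF assms] by simp
qed

lemma reach_states:
  assumes "x \<in> V" "(A', A) \<in> (\<lambda>E. (reach V E x j, reach V E x (Suc j))) ` Pow K"
  shows "A' \<subseteq> A" "A \<subseteq> V"
proof -
  obtain E where "A' = reach V E x j" "A = reach V E x (Suc j)"
    using assms(2) by (auto simp del: reach.simps)
  then show "A' \<subseteq> A" "A \<subseteq> V"
    using reach_mono[of j "Suc j" V E x] reach_subset[OF assms(1), of E "Suc j"]
    by (simp_all del: reach.simps)
qed

lemma disjoint_stars: "disjoint_family_on (\<lambda>z. (\<lambda>a. {a, z}) ` S) (V - S)"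
  unfolding disjoint_family_on_def by (auto simp: doubleton_eq_iff)

text \<open>Given the explored balls, the new sphere counts independent hits. The comparison is with
  the actual, random size of the preceding sphere, so the success of earlier steps need not be
  conditioned on.\<close>

lemma prob_level_upper:
  assumes x: "x \<in> V" and e: "0 < e" "e \<le> 1"
  shows "measure_pmf.prob (random_graph V p) {E. (1 + e) * (real (card V) * (p * real (card (level V E x j)))) + L
    \<le> real (card (level V E x (Suc j)))} \<le> exp (- e * L)"
proof -
  define bad where "bad = (\<lambda>(A', A) E. (1 + e) * (real (card V) * (p * real (card (A - A')))) + L
    \<le> real (card {z \<in> V - A. hit (A - A') z E}))"
  define X where "X = (\<lambda>E. (reach V E x j, reach V E x (Suc j)))"
  have "measure_pmf.prob (random_graph V p) {E. bad (X E) E} \<le> exp (- e * L)"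
  \<comment> \<open>Revealed are the edges meeting the inner ball \<open>A'\<close>; fresh are those
    from the last sphere \<open>A - A'\<close> to the unexplored part \<open>V - A\<close>, which
    form disjoint stars, one for each \<open>z\<close>.\<close>
  proof (rule prob_revealed_le[where I = "\<lambda>(A', A). {e. e \<inter> A' \<noteq> {}}"
        and J = "\<lambda>(A', A). \<Union>z\<in>V - A. (\<lambda>a. {a, z}) ` (A - A')"])
    show "finite (all_edges V)" by (rule finite_all_edges[OF fin])
    show "depends_on (case s of (A', A) \<Rightarrow> {e. e \<inter> A' \<noteq> {}}) (\<lambda>E. X E = s)" for s
      unfolding X_def by (cases s) (simp only: depends_on_reach prod.case)
  next
    fix s assume s: "s \<in> X ` Pow (all_edges V)"
    obtain A' A where sA: "s = (A', A)" by (cases s)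
    have A: "A' \<subseteq> A" "A \<subseteq> V" using reach_states[OF x, of A' A j "all_edges V"] s by (auto simp: sA X_def)
    show "depends_on (case s of (A', A) \<Rightarrow> \<Union>z\<in>V - A. (\<lambda>a. {a, z}) ` (A - A')) (bad s)"
      unfolding sA bad_def prod.case
      by (intro depends_on_comp[of _ _ "\<lambda>B. _ \<le> real (card B)"] depends_on_ball depends_on_mono[OF depends_on_hit]) auto
    show "(case s of (A', A) \<Rightarrow> {e. e \<inter> A' \<noteq> {}}) \<inter>
        (case s of (A', A) \<Rightarrow> \<Union>z\<in>V - A. (\<lambda>a. {a, z}) ` (A - A')) = {}"
      using A by (auto simp: sA)
    have "(\<Sum>z\<in>V - A. measure_pmf.prob (random_graph V p) {E. hit (A - A') z E}) \<le>
        (\<Sum>z\<in>V - A. p * real (card (A - A')))"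
      using A by (intro sum_mono prob_hit_le) auto
    also have "\<dots> \<le> real (card V) * (p * real (card (A - A')))"
      using fin p by (auto intro!: mult_right_mono card_mono)
    finally have mean: "(\<Sum>z\<in>V - A. measure_pmf.prob (random_graph V p) {E. hit (A - A') z E}) \<le>
      real (card V) * (p * real (card (A - A')))" .
    show "measure_pmf.prob (random_graph V p) {E. bad s E} \<le> exp (- e * L)"
      unfolding sA bad_def prod.case
    proof (rule chernoff_upper[OF finite_all_edges[OF fin] _ depends_on_hit _ mean e])
      show "disjoint_family_on (\<lambda>z. (\<lambda>a. {a, z}) ` (A - A')) (V - A)"
        by (rule disjoint_family_on_mono[OF _ disjoint_stars]) auto
    qed (use fin in auto)
  qed simp
  then show ?thesis by (simp add: bad_def X_def level_Suc[OF x] level_def[symmetric] del: reach.simps)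
qed

text \<open>The condition that \<open>p\<close> times the sphere is at most 1 belongs to the event,
  so it may be assumed once the state is fixed. It keeps the bound on the mean nonnegative, as
  \<open>chernoff_lower\<close> demands of \<open>m\<close>.\<close>

lemma prob_level_lower:
  assumes x: "x \<in> V" and e: "0 < e" "e \<le> 1"
  shows "measure_pmf.prob (random_graph V p) {E. p * real (card (level V E x j)) \<le> 1 \<and> real (card (level V E x (Suc j))) \<le>
      (1 - e) * ((real (card V) - real (card (reach V E x (Suc j)))) *
        (p * real (card (level V E x j)) - (p * real (card (level V E x j)))\<^sup>2)) - L} \<le> exp (- e * L)"
proof -
  define bad where "bad = (\<lambda>(A', A) E. p * real (card (A - A')) \<le> 1 \<and>
    real (card {z \<in> V - A. hit (A - A') z E}) \<le> (1 - e) * ((real (card V) - real (card A)) *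
        (p * real (card (A - A')) - (p * real (card (A - A')))\<^sup>2)) - L)"
  define X where "X = (\<lambda>E. (reach V E x j, reach V E x (Suc j)))"
  have "measure_pmf.prob (random_graph V p) {E. bad (X E) E} \<le> exp (- e * L)"
  proof (rule prob_revealed_le[where I = "\<lambda>(A', A). {e. e \<inter> A' \<noteq> {}}"
        and J = "\<lambda>(A', A). \<Union>z\<in>V - A. (\<lambda>a. {a, z}) ` (A - A')"])
    show "finite (all_edges V)" by (rule finite_all_edges[OF fin])
    show "depends_on (case s of (A', A) \<Rightarrow> {e. e \<inter> A' \<noteq> {}}) (\<lambda>E. X E = s)" for s
      unfolding X_def by (cases s) (simp only: depends_on_reach prod.case)
  next
    fix s assume s: "s \<in> X ` Pow (all_edges V)"
    obtain A' A where sA: "s = (A', A)" by (cases s)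
    have A: "A' \<subseteq> A" "A \<subseteq> V" using reach_states[OF x, of A' A j "all_edges V"] s by (auto simp: sA X_def)
    show "depends_on (case s of (A', A) \<Rightarrow> \<Union>z\<in>V - A. (\<lambda>a. {a, z}) ` (A - A')) (bad s)"
      unfolding sA bad_def prod.case
      by (intro depends_on_comp[of _ _ "\<lambda>B. _ \<and> real (card B) \<le> _"] depends_on_ball depends_on_mono[OF depends_on_hit]) auto
    show "(case s of (A', A) \<Rightarrow> {e. e \<inter> A' \<noteq> {}}) \<inter>
        (case s of (A', A) \<Rightarrow> \<Union>z\<in>V - A. (\<lambda>a. {a, z}) ` (A - A')) = {}"
      using A by (auto simp: sA)
    show "measure_pmf.prob (random_graph V p) {E. bad s E} \<le> exp (- e * L)"
    proof (cases "p * real (card (A - A')) \<le> 1")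
      case False
      then show ?thesis by (simp add: sA bad_def)
    next
      case True
      let ?q = "p * real (card (A - A')) - (p * real (card (A - A')))\<^sup>2"
      have q: "0 \<le> ?q" using True p by (simp add: power2_eq_square mult_left_le)
      have cV: "real (card V) - real (card A) = real (card (V - A))"
        using A fin by (simp add: card_Diff_subset card_mono finite_subset of_nat_diff)
      have "(real (card V) - real (card A)) * ?q = (\<Sum>z\<in>V - A. ?q)" by (simp add: cV)
      also have "\<dots> \<le> (\<Sum>z\<in>V - A. measure_pmf.prob (random_graph V p) {E. hit (A - A') z E})"
        using A by (intro sum_mono prob_hit_ge) auto
      finally have mean: "(real (card V) - real (card A)) * ?q \<le>
          (\<Sum>z\<in>V - A. measure_pmf.prob (random_graph V p) {E. hit (A - A') z E})" .
      have "measure_pmf.prob (random_graph V p) {E. real (card {z \<in> V - A. hit (A - A') z E}) \<le>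
          (1 - e) * ((real (card V) - real (card A)) * ?q) - L} \<le> exp (- e * L)"
      proof (rule chernoff_lower[OF finite_all_edges[OF fin] _ depends_on_hit _ mean _ e])
        show "disjoint_family_on (\<lambda>z. (\<lambda>a. {a, z}) ` (A - A')) (V - A)"
          by (rule disjoint_family_on_mono[OF _ disjoint_stars]) auto
      qed (use fin q cV in auto)
      then show ?thesis using True by (simp add: sA bad_def)
    qed
  qed simp
  then show ?thesis by (simp add: bad_def X_def level_Suc[OF x] level_def[symmetric] del: reach.simps)
qed

lemma prob_merge_set:
  assumes x: "x \<in> V" and y: "y \<in> V" and e: "0 < e" "e \<le> 1"
  shows "measure_pmf.prob (random_graph V p) {E. (1 + e) * (real (card V) * ((p * real (card (level V E x j))) *
      (p * real (card (level V E y j))))) + L \<le> real (card (merge_set V E x y j))} \<le> exp (- e * L)"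
proof -
  define bad where "bad = (\<lambda>((A', A), (C', C)) E.
    (1 + e) * (real (card V) * ((p * real (card (A - A'))) * (p * real (card (C - C'))))) + L
    \<le> real (card {z \<in> V - A - C. hit (A - A' - C) z E \<and> hit (C - C' - A) z E}))"
  define I :: "('a set \<times> 'a set) \<times> 'a set \<times> 'a set \<Rightarrow> 'a set set"
    where "I = (\<lambda>((A', A), (C', C)). {e. e \<inter> A' \<noteq> {}} \<union> {e. e \<inter> C' \<noteq> {}})"
  define J :: "('a set \<times> 'a set) \<times> 'a set \<times> 'a set \<Rightarrow> 'a set set"
    where "J = (\<lambda>((A', A), (C', C)). \<Union>z\<in>V - A - C. (\<lambda>a. {a, z}) ` ((A - A' - C) \<union> (C - C' - A)))"
  define X where "X = (\<lambda>E. ((reach V E x j, reach V E x (Suc j)), (reach V E y j, reach V E y (Suc j))))"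
  have "measure_pmf.prob (random_graph V p) {E. bad (X E) E} \<le> exp (- e * L)"
  proof (rule prob_revealed_le[where I = I and J = J])
    show "finite (all_edges V)" by (rule finite_all_edges[OF fin])
    show "depends_on (I s) (\<lambda>E. X E = s)" for s
    proof -
      obtain A' A C' C where s: "s = ((A', A), (C', C))" by (metis prod.exhaust)
      have "depends_on (I s) (\<lambda>E. (reach V E x j, reach V E x (Suc j)) = (A', A) \<and>
          (reach V E y j, reach V E y (Suc j)) = (C', C))"
        by (intro depends_on_comp2[of _ _ _ "(\<and>)"] depends_on_mono[OF depends_on_reach])
          (auto simp: s I_def)
      then show ?thesis by (simp add: s X_def del: reach.simps)
    qed
  next
    fix s assume s: "s \<in> X ` Pow (all_edges V)"
    obtain A' A C' C where sA: "s = ((A', A), (C', C))" by (metis prod.exhaust)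
    have A: "A' \<subseteq> A" "A \<subseteq> V" "C' \<subseteq> C" "C \<subseteq> V"
      using reach_states[OF x, of A' A j "all_edges V"] reach_states[OF y, of C' C j "all_edges V"] s
      by (auto simp: sA X_def)
    define P where "P = A - A' - C"
    define Q where "Q = C - C' - A"
    have PQ: "P \<inter> Q = {}" "P \<subseteq> V" "Q \<subseteq> V" using A by (auto simp: P_def Q_def)
    have dep: "depends_on ((\<lambda>a. {a, z}) ` (P \<union> Q)) (\<lambda>E. hit P z E \<and> hit Q z E)" for z
      by (intro depends_on_comp2[of _ _ _ "(\<and>)"] depends_on_mono[OF depends_on_hit]) auto
    show "depends_on (J s) (bad s)"
      unfolding sA bad_def J_def prod.case P_def[symmetric] Q_def[symmetric]
      by (intro depends_on_comp[of _ _ "\<lambda>B. _ \<le> real (card B)"] depends_on_ball depends_on_mono[OF dep]) auto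
    \<comment> \<open>The end \<open>a\<close> of a fresh edge must avoid both inner balls; taking
      the whole opposite ball out of each sphere ensures it.\<close>
    show "I s \<inter> J s = {}"
      using A by (auto simp: sA I_def J_def)
    have "measure_pmf.prob (random_graph V p) {E. hit P z E \<and> hit Q z E} \<le> (p * real (card (A - A'))) * (p * real (card (C - C')))"
      if z: "z \<in> V - A - C" for z
    proof -
      have "measure_pmf.prob (random_graph V p) {E. hit P z E \<and> hit Q z E} =
          measure_pmf.prob (random_graph V p) {E. hit P z E} * measure_pmf.prob (random_graph V p) {E. hit Q z E}"
        using PQ by (intro prob_conj_depends_on[OF finite_all_edges[OF fin] depends_on_hit depends_on_hit])
          (auto simp: doubleton_eq_iff)
      also have "\<dots> \<le> (p * real (card P)) * (p * real (card Q))"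
        using PQ p z by (intro mult_mono prob_hit_le) (auto simp: P_def Q_def)
      also have "\<dots> \<le> (p * real (card (A - A'))) * (p * real (card (C - C')))"
        using p A fin by (intro mult_mono mult_left_mono)
          (auto intro!: card_mono simp: P_def Q_def intro: finite_subset)
      finally show ?thesis .
    qed
    then have "(\<Sum>z\<in>V - A - C. measure_pmf.prob (random_graph V p) {E. hit P z E \<and> hit Q z E}) \<le>
        (\<Sum>z\<in>V - A - C. (p * real (card (A - A'))) * (p * real (card (C - C'))))"
      by (rule sum_mono)
    also have "\<dots> \<le> real (card V) * ((p * real (card (A - A'))) * (p * real (card (C - C'))))"
    proof -
      have "real (card (V - A - C)) \<le> real (card V)" using fin by (intro of_nat_mono card_mono) auto
      then show ?thesis using p by (simp add: mult_right_mono)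
    qed
    finally have mean: "(\<Sum>z\<in>V - A - C. measure_pmf.prob (random_graph V p) {E. hit P z E \<and> hit Q z E}) \<le>
      real (card V) * ((p * real (card (A - A'))) * (p * real (card (C - C'))))" .
    show "measure_pmf.prob (random_graph V p) {E. bad s E} \<le> exp (- e * L)"
      unfolding sA bad_def prod.case P_def[symmetric] Q_def[symmetric]
    proof (rule chernoff_upper[OF finite_all_edges[OF fin] _ dep _ mean e])
      show "disjoint_family_on (\<lambda>z. (\<lambda>a. {a, z}) ` (P \<union> Q)) (V - A - C)"
        by (rule disjoint_family_on_mono[OF _ disjoint_stars]) (auto simp: P_def Q_def)
    qed (use fin in auto)
  qed simp
  then show ?thesis
    by (simp add: bad_def X_def merge_set_def level_def[symmetric] del: reach.simps)
qed

end

section \<open>Sizes of balls and of their intersections\<close>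

lemma card_nbrs_le:
  assumes "finite V" "A \<subseteq> V" "\<And>w. w \<in> A \<Longrightarrow> real (card (reach V E w 2)) \<le> c"
  shows "real (card (nbrs V E A)) \<le> real (card A) * c"
proof -
  have finA: "finite A" using assms finite_subset by blast
  have two: "reach V E w 2 = insert w (insert w {} \<union> nbrs V E {w})" for w
    by (simp add: numeral_2_eq_2 nbrs_def)
  have "nbrs V E A \<subseteq> (\<Union>w\<in>A. reach V E w 2)" by (auto simp: two nbrs_def)
  moreover have "finite (reach V E w 2)" if "w \<in> A" for w
    using reach_subset[of w V E 2] that assms(1,2) finite_subset by blast
  ultimately have "card (nbrs V E A) \<le> card (\<Union>w\<in>A. reach V E w 2)"
    using finA by (intro card_mono) auto
  also have "\<dots> \<le> (\<Sum>w\<in>A. card (reach V E w 2))" by (rule card_UN_le[OF finA])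
  finally have "real (card (nbrs V E A)) \<le> (\<Sum>w\<in>A. real (card (reach V E w 2)))"
    by (simp flip: of_nat_sum)
  also have "\<dots> \<le> (\<Sum>w\<in>A. c)" using assms(3) by (intro sum_mono)
  finally show ?thesis by simp
qed

definition meet :: "'a set \<Rightarrow> 'a set set \<Rightarrow> 'a \<Rightarrow> 'a \<Rightarrow> nat \<Rightarrow> 'a set" where
  "meet V E x y j = reach V E x (Suc j) \<inter> reach V E y (Suc j)"

lemma meet_0: "x \<noteq> y \<Longrightarrow> meet V E x y 0 = {}"
  by (simp add: meet_def reach_1 del: reach.simps)

text \<open>A vertex new to both balls has a predecessor in each last sphere. If one predecessor
  lies in both balls, the vertex is a neighbour of the old intersection; otherwise each lies outside
  the opposite ball, and the vertex is a merge. Vertices reached earlier by one search are covered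
  by the two smaller balls.\<close>

lemma meet_Suc_subset:
  assumes x: "x \<in> V" and y: "y \<in> V"
  shows "meet V E x y (Suc j) \<subseteq> reach V E x (Suc j) \<union> reach V E y (Suc j) \<union> merge_set V E x y j
    \<union> nbrs V E (meet V E x y j)"
proof
  fix z assume z: "z \<in> meet V E x y (Suc j)"
  show "z \<in> reach V E x (Suc j) \<union> reach V E y (Suc j) \<union> merge_set V E x y j \<union> nbrs V E (meet V E x y j)"
  proof (rule ccontr)
    assume neg: "\<not> ?thesis"
    then have lev: "z \<in> level V E x (Suc j)" "z \<in> level V E y (Suc j)"
      using z by (auto simp: meet_def level_def simp del: reach.simps)
    then obtain a b where ab: "a \<in> level V E x j" "{a, z} \<in> E" "b \<in> level V E y j" "{b, z} \<in> E" "z \<in> V"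
      unfolding level_Suc[OF x] level_Suc[OF y] hit_def by blast
    have "a \<notin> meet V E x y j" "b \<notin> meet V E x y j" using neg ab by (auto simp: nbrs_def)
    then have "a \<notin> reach V E y (Suc j)" "b \<notin> reach V E x (Suc j)"
      using ab by (auto simp: meet_def level_def simp del: reach.simps)
    then have "z \<in> merge_set V E x y j"
      using neg ab by (auto simp: merge_set_def hit_def simp del: reach.simps)
    then show False using neg by blast
  qed
qed

text \<open>Unrolling the recursion: every common vertex descends from some stage \<open>j\<close>,
  at distance at most \<open>m - j - 1\<close> from a vertex that entered there. This is crude, but
  below the last radius the intersection only contributes to the error.\<close>

lemma meet_subset:
  assumes x: "x \<in> V" and y: "y \<in> V" and xy: "x \<noteq> y"
  shows "meet V E x y m \<subseteq> (\<Union>j<m. \<Union>w \<in> reach V E x (Suc j) \<union> reach V E y (Suc j) \<union> merge_set V E x y j.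
    reach V E w (m - j))"
proof (induction m)
  case 0
  then show ?case using meet_0[OF xy] by simp
next
  case (Suc m)
  let ?K = "\<lambda>j. reach V E x (Suc j) \<union> reach V E y (Suc j) \<union> merge_set V E x y j"
  show ?case
  proof
    fix z assume "z \<in> meet V E x y (Suc m)"
    then consider "z \<in> ?K m" | "z \<in> nbrs V E (meet V E x y m)"
      using meet_Suc_subset[OF x y, of E m] by blast
    then show "z \<in> (\<Union>j<Suc m. \<Union>w \<in> ?K j. reach V E w (Suc m - j))"
    proof cases
      case 1
      then show ?thesis by (intro UN_I[of m] UN_I[of z]) auto
    next
      case 2
      then obtain a where a: "a \<in> meet V E x y m" "{a, z} \<in> E" "z \<in> V" by (auto simp: nbrs_def)
      then obtain j w where jw: "j < m" "w \<in> ?K j" "a \<in> reach V E w (m - j)"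
        using Suc.IH by blast
      have "z \<in> reach V E w (Suc (m - j))" using reach_step[OF jw(3) a(2,3)] .
      then show ?thesis using jw by (intro UN_I[of j] UN_I[of w]) (auto simp: Suc_diff_le simp del: reach.simps)
    qed
  qed
qed

lemma sum_powers_le:
  fixes d :: real
  assumes "2 \<le> d"
  shows "d * (\<Sum>j<m. d ^ (m - j - 1)) \<le> 2 * d ^ m"
proof -
  have "(\<Sum>j<m. d ^ (m - j - 1)) = (\<Sum>j<m. d ^ j)"
    using sum.nat_diff_reindex[of "\<lambda>j. d ^ j" m] by simp
  also have "d * \<dots> \<le> 2 * d ^ m"
  proof (induction m)
    case (Suc m)
    have "2 * d ^ m \<le> d * d ^ m" using assms by (intro mult_right_mono) auto
    then show ?case using Suc by (simp add: algebra_simps)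
  qed simp
  finally show ?thesis by simp
qed

text \<open>The deterministic output of the exploration, with \<open>l\<close> later set to
  \<open>ln n\<close>. For a relative error \<open>r\<close> the additive term
  \<open>4 l / r\<close> makes the Chernoff bounds fail with probability at most
  \<open>exp (- 4 l)\<close>. The error halves with \<open>j\<close> for spheres, whose estimates
  are iterated, but not for merges, whose estimates are only summed.\<close>

locale expanding_graph =
  fixes V :: "'a set" and E :: "'a set set" and p n d l e :: real and i :: nat
  assumes fin: "finite V" and n_def: "n = real (card V)" and n_pos: "0 < n" and d_def: "d = n * p"
    and e: "0 < e" "e \<le> 1/10"
    and d_ge_4: "4 \<le> d" and d_ge: "16 * l \<le> e\<^sup>2 * d" and l: "1 \<le> l" and i_le: "real i \<le> l" and i_pos: "1 \<le> i"
    and ball_small: "d ^ i \<le> e * n" and next_large: "150 * (n * l) \<le> e\<^sup>2 * d ^ (i + 1)"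
    and up: "\<And>x j. x \<in> V \<Longrightarrow> j < i \<Longrightarrow> real (card (level V E x (Suc j))) <
      (1 + e / 2 ^ Suc j) * (n * (p * real (card (level V E x j)))) + 4 * l / (e / 2 ^ Suc j)"
    and lo: "\<And>x j. x \<in> V \<Longrightarrow> j < i \<Longrightarrow> p * real (card (level V E x j)) \<le> 1 \<Longrightarrow>
      (1 - e / 2 ^ Suc j) * ((n - real (card (reach V E x (Suc j)))) *
        (p * real (card (level V E x j)) - (p * real (card (level V E x j)))\<^sup>2)) - 4 * l / (e / 2 ^ Suc j)
      < real (card (level V E x (Suc j)))"
    and mg: "\<And>x y j. x \<in> V \<Longrightarrow> y \<in> V \<Longrightarrow> x \<noteq> y \<Longrightarrow> j < i \<Longrightarrow> real (card (merge_set V E x y j)) <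
      (1 + e) * (n * ((p * real (card (level V E x j))) * (p * real (card (level V E y j))))) + 4 * l / e"
begin

section \<open>Growth of spheres and balls\<close>

lemma d_pos: "0 < d" using d_ge_4 by simp
lemma p_eq: "p = d / n" using n_pos by (simp add: d_def)

text \<open>After clearing denominators, halving the error costs a factor \<open>4^(j+1)\<close>.
  Here \<open>d \<ge> 4\<close> pays for \<open>4^j\<close> and \<open>16 l \<le> e^2 d\<close> for
  the rest, whatever the number of radii.\<close>

lemma additive_error: "4 * l / (e / 2 ^ Suc j) \<le> e / 2 ^ Suc j * d ^ Suc j"
proof -
  have "4 * l * (2 ^ Suc j * 2 ^ Suc j) = 16 * l * 4 ^ j"
    by (simp add: power_mult_distrib[symmetric])
  also have "\<dots> \<le> (e\<^sup>2 * d) * d ^ j"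
    using d_ge d_ge_4 l by (intro mult_mono[of "16 * l"] power_mono) auto
  finally have "4 * l * (2 ^ Suc j * 2 ^ Suc j) \<le> e\<^sup>2 * d ^ Suc j" by simp
  then show ?thesis using e by (simp add: field_simps power2_eq_square)
qed

text \<open>With \<open>h = 1 / 2^(j+1)\<close> a step adds relative error at most
  \<open>3 e h\<close>: \<open>2 e h\<close> from the factor \<open>1 + e h\<close>, the sphere
  being at most \<open>2 d^j\<close>, and \<open>e h\<close> from the additive term. The sum
  telescopes to \<open>3 e (1 - 1 / 2^j)\<close>.\<close>

lemma level_upper_aux:
  assumes x: "x \<in> V" and "j \<le> i"
  shows "real (card (level V E x j)) \<le> (1 + 3 * e * (1 - 1 / 2 ^ j)) * d ^ j"
  using assms(2)
proof (induction j)
  case 0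
  then show ?case by (simp add: level_0)
next
  case (Suc j)
  let ?s = "real (card (level V E x j))"
  define h where "h = (1::real) / 2 ^ Suc j"
  have h: "0 \<le> h" "1 / 2 ^ j = 2 * h" by (auto simp: h_def)
  have IH: "?s \<le> (1 + 3 * e * (1 - 2 * h)) * d ^ j" using Suc h by simp
  have "3 * e * (1 - 2 * h) \<le> 3 * e * 1" using e h by (intro mult_left_mono) auto
  then have "1 + 3 * e * (1 - 2 * h) \<le> 2" using e by linarith
  then have "(1 + 3 * e * (1 - 2 * h)) * d ^ j \<le> 2 * d ^ j" using d_pos by (intro mult_right_mono) auto
  then have s2: "?s \<le> 2 * d ^ j" using IH by linarith
  have "real (card (level V E x (Suc j))) \<le> (1 + e * h) * (d * ?s) + e * h * d ^ Suc j"
    using up[OF x, of j] Suc.prems additive_error[of j] by (simp add: h_def d_def mult.assoc)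
  also have "\<dots> = d * ?s + e * h * (d * ?s) + e * h * d ^ Suc j" by (simp add: algebra_simps)
  also have "\<dots> \<le> d * ((1 + 3 * e * (1 - 2 * h)) * d ^ j) + e * h * (d * (2 * d ^ j)) + e * h * d ^ Suc j"
    using IH s2 e h d_pos by (intro add_mono mult_left_mono) auto
  also have "\<dots> = (1 + 3 * e * (1 - h)) * d ^ Suc j" by (simp add: algebra_simps)
  finally show ?case by (simp only: h_def)
qed

lemma level_upper:
  assumes "x \<in> V" "j \<le> i"
  shows "real (card (level V E x j)) \<le> (1 + 3 * e) * d ^ j"
proof -
  have "(1 + 3 * e * (1 - 1 / 2 ^ j)) * d ^ j \<le> (1 + 3 * e * 1) * d ^ j"
    using e d_pos by (intro mult_right_mono add_left_mono mult_left_mono) auto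
  then show ?thesis using level_upper_aux[OF assms] by simp
qed

lemma level_le:
  assumes "x \<in> V" "j \<le> i"
  shows "real (card (level V E x j)) \<le> 2 * d ^ j"
proof -
  have "(1 + 3 * e) * d ^ j \<le> 2 * d ^ j" using e d_pos by (intro mult_right_mono) auto
  then show ?thesis using level_upper[OF assms] by linarith
qed

lemma finite_reach: "x \<in> V \<Longrightarrow> finite (reach V E x j)"
  using reach_subset fin finite_subset by metis

lemma reach_le:
  assumes x: "x \<in> V" and "j \<le> i"
  shows "real (card (reach V E x (Suc j))) \<le> 4 * d ^ j"
  using assms(2)
proof (induction j)
  case 0
  then show ?case by (simp add: reach_1 del: reach.simps)
next
  case (Suc j)
  have "reach V E x (Suc (Suc j)) = reach V E x (Suc j) \<union> level V E x (Suc j)"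
    using reach_mono[of "Suc j" "Suc (Suc j)" V E x] by (auto simp: level_def simp del: reach.simps)
  then have "card (reach V E x (Suc (Suc j))) \<le> card (reach V E x (Suc j)) + card (level V E x (Suc j))"
    by (simp only: card_Un_le)
  then have "real (card (reach V E x (Suc (Suc j)))) \<le> 4 * d ^ j + 2 * d ^ Suc j"
    using Suc level_le[OF x Suc.prems] by linarith
  also have "4 * d ^ j \<le> d * d ^ j" using d_ge_4 by (intro mult_right_mono) auto
  finally show ?case using d_pos by simp
qed

text \<open>Besides the Chernoff errors, vertices are lost to the explored ball and to repeated
  hits. With \<open>w = d^(j+1) / n\<close> these relative losses are at most \<open>w\<close> and
  \<open>2 w\<close>; the sphere bound \<open>2 d^j\<close> turns \<open>3 w\<close> into
  \<open>6 w\<close>, and \<open>12 d^j / n \<le> 6 w\<close> reproduces the constant 12.\<close>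

lemma level_lower_aux:
  assumes x: "x \<in> V" and "j \<le> i"
  shows "(1 - 3 * e * (1 - 1 / 2 ^ j) - 12 * d ^ j / n) * d ^ j \<le> real (card (level V E x j))"
  using assms(2)
proof (induction j)
  case 0
  then show ?case using n_pos by (simp add: level_0)
next
  case (Suc j)
  let ?s = "real (card (level V E x j))" and ?b = "real (card (reach V E x (Suc j)))"
  define h where "h = (1::real) / 2 ^ Suc j"
  define w where "w = d ^ Suc j / n"
  have "1 \<le> (2::real) ^ Suc j" by (rule one_le_power) simp
  then have h: "0 \<le> h" "h \<le> 1" "1 / 2 ^ j = 2 * h" by (auto simp: h_def)
  have w: "0 \<le> w" using n_pos d_pos by (simp add: w_def)
  have dj: "0 < d ^ j" using d_pos by simp
  have IH: "(1 - 3 * e * (1 - 2 * h) - 12 * d ^ j / n) * d ^ j \<le> ?s" using Suc h by simp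
  have s2: "?s \<le> 2 * d ^ j" using level_le[OF x] Suc.prems by simp
  have "d ^ Suc j \<le> d ^ i" using Suc.prems d_ge_4 by (intro power_increasing) auto
  then have "w \<le> e" using ball_small n_pos by (simp add: w_def field_simps)
  have ps: "p * ?s = d * ?s / n" by (simp add: p_eq)
  have "d * ?s \<le> d * (2 * d ^ j)" using s2 d_pos by (intro mult_left_mono) auto
  then have ps_le: "p * ?s \<le> 2 * w" using n_pos by (simp add: ps w_def field_simps)
  then have ps1: "p * ?s \<le> 1" using \<open>w \<le> e\<close> e by linarith
  have ps0: "0 \<le> p * ?s" using n_pos d_pos by (simp add: ps)
  have b: "?b / n \<le> w"
  proof -
    have "?b \<le> 4 * d ^ j" using reach_le[OF x] Suc.prems by simp
    also have "\<dots> \<le> d * d ^ j" using d_ge_4 by (intro mult_right_mono) auto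
    finally show ?thesis using n_pos by (simp add: w_def divide_right_mono)
  qed
  have eh: "e / 2 ^ Suc j = e * h" by (simp add: h_def)
  have eh1: "0 \<le> e * h" "e * h \<le> 1" using e h mult_mono[of e 1 h 1] by auto
  have 12: "12 * d ^ j / n + 6 * w \<le> 12 * w"
  proof -
    have "2 * d ^ j \<le> d * d ^ j" using d_ge_4 by (intro mult_right_mono) auto
    then show ?thesis using n_pos by (simp add: w_def field_simps)
  qed
  have "(1 - 3 * e * (1 - h) - 12 * w) * d ^ Suc j \<le>
      (1 - 3 * e * (1 - 2 * h) - 12 * d ^ j / n) * d ^ Suc j - 2 * d ^ Suc j * (e * h + 3 * w) - e * h * d ^ Suc j"
  proof -
    have "(1 - 3 * e * (1 - h) - 12 * w) * d ^ Suc j \<le>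
        (1 - 3 * e * (1 - 2 * h) - 12 * d ^ j / n - 2 * (e * h + 3 * w) - e * h) * d ^ Suc j"
      using 12 d_pos by (intro mult_right_mono) (auto simp: algebra_simps)
    then show ?thesis by (simp add: algebra_simps)
  qed
  also have "\<dots> \<le> d * ?s - d * ?s * (e * h + 3 * w) - e * h * d ^ Suc j"
  proof -
    have "(1 - 3 * e * (1 - 2 * h) - 12 * d ^ j / n) * d ^ Suc j \<le> d * ?s"
      using mult_left_mono[OF IH, of d] d_pos by (simp add: algebra_simps)
    moreover have "d * ?s * (e * h + 3 * w) \<le> 2 * d ^ Suc j * (e * h + 3 * w)"
      using \<open>d * ?s \<le> d * (2 * d ^ j)\<close> eh1 w by (intro mult_right_mono) auto
    ultimately show ?thesis by linarith
  qed
  also have "\<dots> \<le> d * ?s * ((1 - e * h) * ((1 - ?b / n) * (1 - p * ?s))) - e * h * d ^ Suc j"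
  proof -
    have alg: "(1 - a) * (1 - c) = 1 - a - c + a * c" for a c :: real by (simp add: algebra_simps)
    have "0 \<le> ?b / n" using n_pos by simp
    then have "0 \<le> ?b / n * (p * ?s)" using ps0 by (rule mult_nonneg_nonneg)
    then have "1 - ?b / n - p * ?s \<le> (1 - ?b / n) * (1 - p * ?s)" unfolding alg by linarith
    then have "(1 - e * h) * (1 - ?b / n - p * ?s) \<le> (1 - e * h) * ((1 - ?b / n) * (1 - p * ?s))"
      using eh1 by (intro mult_left_mono) auto
    moreover have "1 - e * h - (?b / n + p * ?s) \<le> (1 - e * h) * (1 - ?b / n - p * ?s)"
    proof -
      have "0 \<le> e * h * (?b / n + p * ?s)" 
        using eh1(1) ps0 n_pos by (intro mult_nonneg_nonneg[OF eh1(1)] add_nonneg_nonneg[OF _ ps0]) auto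
      moreover have "(1 - a) * (1 - b - c) = 1 - a - (b + c) + a * (b + c)" for a b c :: real
        by (simp add: algebra_simps)
      ultimately show ?thesis by simp
    qed
    ultimately have "1 - (e * h + 3 * w) \<le> (1 - e * h) * ((1 - ?b / n) * (1 - p * ?s))"
      using b ps_le by linarith
    then have "d * ?s * (1 - (e * h + 3 * w)) \<le> d * ?s * ((1 - e * h) * ((1 - ?b / n) * (1 - p * ?s)))"
      using d_pos by (intro mult_left_mono) auto
    then show ?thesis by (simp add: algebra_simps)
  qed
  also have "\<dots> = (1 - e * h) * ((n - ?b) * (p * ?s - (p * ?s)\<^sup>2)) - e * h * d ^ Suc j"
  proof -
    have "(n - b) * (q - q\<^sup>2) = n * q * ((1 - b / n) * (1 - q))" for b q
      using n_pos by (simp add: field_simps power2_eq_square)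
    moreover have "n * (p * ?s) = d * ?s" using n_pos by (simp add: p_eq)
    ultimately have "(n - ?b) * (p * ?s - (p * ?s)\<^sup>2) = d * ?s * ((1 - ?b / n) * (1 - p * ?s))"
      by metis
    then show ?thesis by (simp only: mult.left_commute)
  qed
  also have "\<dots> \<le> real (card (level V E x (Suc j)))"
    using lo[OF x _ ps1] Suc.prems additive_error[of j] unfolding eh by linarith
  finally show ?case by (simp only: h_def w_def times_divide_eq_right)
qed

text \<open>The last sphere alone is large enough; \<open>15 = 3 + 12\<close>, the saturation term
  being at most \<open>12 e\<close> by \<open>d^i \<le> e n\<close>.\<close>

lemma reach_ge:
  assumes x: "x \<in> V"
  shows "(1 - 15 * e) * d ^ i \<le> real (card (reach V E x (Suc i)))"
proof -
  have "12 * d ^ i / n \<le> 12 * e" using ball_small n_pos by (simp add: field_simps)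
  moreover have "3 * e * (1 - 1 / 2 ^ i) \<le> 3 * e * 1" using e by (intro mult_left_mono) auto
  ultimately have "1 - 15 * e \<le> 1 - 3 * e * (1 - 1 / 2 ^ i) - 12 * d ^ i / n" by linarith
  then have "(1 - 15 * e) * d ^ i \<le> (1 - 3 * e * (1 - 1 / 2 ^ i) - 12 * d ^ i / n) * d ^ i"
    using d_pos by (intro mult_right_mono) auto
  also have "\<dots> \<le> real (card (level V E x i))" using level_lower_aux[OF x] by simp
  also have "\<dots> \<le> real (card (reach V E x (Suc i)))"
    using finite_reach[OF x] by (intro of_nat_mono card_mono) (auto simp: level_def simp del: reach.simps)
  finally show ?thesis .
qed

text \<open>For \<open>j = i - 1\<close> this is the main term \<open>D^2 / n\<close> of the
  intersection, so the coefficient must stay close to 1. Smaller \<open>j\<close> get by with the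
  coarser \<open>merge_set_le\<close>.\<close>

lemma merge_set_le_coeff:
  assumes x: "x \<in> V" and y: "y \<in> V" and xy: "x \<noteq> y" and j: "j < i"
  shows "real (card (merge_set V E x y j)) \<le> (1 + 9 * e) * (d ^ (2 * j + 2) / n) + 4 * l / e"
proof -
  let ?s = "real (card (level V E x j))" and ?t = "real (card (level V E y j))"
  have st: "?s * ?t \<le> ((1 + 3 * e) * d ^ j) * ((1 + 3 * e) * d ^ j)"
    using level_upper[OF x] level_upper[OF y] j e d_pos by (intro mult_mono) auto
  have "(1 + e) * (n * ((p * ?s) * (p * ?t))) = (1 + e) * (d\<^sup>2 / n) * (?s * ?t)"
    using n_pos by (simp add: p_eq power2_eq_square)
  also have "\<dots> \<le> (1 + e) * (d\<^sup>2 / n) * (((1 + 3 * e) * d ^ j) * ((1 + 3 * e) * d ^ j))"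
    using st e n_pos by (intro mult_left_mono) auto
  also have "\<dots> = ((1 + e) * (1 + 3 * e)\<^sup>2) * (d ^ (2 * j + 2) / n)"
    by (simp add: power_add power_mult power2_eq_square power_mult_distrib)
  also have "\<dots> \<le> (1 + 9 * e) * (d ^ (2 * j + 2) / n)"
  proof (rule mult_right_mono)
    have e2: "e * e \<le> e * (1/10)" using e by (intro mult_left_mono) auto
    moreover have "e * (e * e) \<le> e * (1/100)"
      using mult_mono[of e "1/10" e "1/10"] e by (intro mult_left_mono) auto
    moreover have "(1 + e) * (1 + 3 * e)\<^sup>2 = 1 + 7 * e + 15 * (e * e) + 9 * (e * (e * e))"
      by (simp add: power2_eq_square algebra_simps)
    ultimately show "(1 + e) * (1 + 3 * e)\<^sup>2 \<le> 1 + 9 * e" using e(1) by linarith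
  qed (use n_pos d_pos in auto)
  finally show ?thesis using mg[OF x y xy j] by linarith
qed

lemma merge_set_le:
  assumes "x \<in> V" "y \<in> V" "x \<noteq> y" "j < i"
  shows "real (card (merge_set V E x y j)) \<le> 2 * (d ^ (2 * j + 2) / n) + 4 * l / e"
proof -
  have "(1 + 9 * e) * (d ^ (2 * j + 2) / n) \<le> 2 * (d ^ (2 * j + 2) / n)"
    using e d_pos n_pos by (intro mult_right_mono) auto
  then show ?thesis using merge_set_le_coeff[OF assms] by linarith
qed

text \<open>Adds up the balls of \<open>meet_subset\<close>. The factor \<open>d\<close> on the left
  anticipates the degree bound of the last step and avoids \<open>d^(m-1)\<close>, which truncated
  subtraction would distort at \<open>m = 0\<close>.\<close>

lemma meet_le:
  assumes x: "x \<in> V" and y: "y \<in> V" and xy: "x \<noteq> y" and m: "m < i"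
  shows "d * real (card (meet V E x y m)) \<le>
    32 * real m * d ^ m + 8 * real m * (d ^ (2 * m + 1) / n) + 32 * l / e * d ^ m"
proof -
  let ?K = "\<lambda>j. reach V E x (Suc j) \<union> reach V E y (Suc j) \<union> merge_set V E x y j"
  have KV: "?K j \<subseteq> V" for j
    using reach_subset[OF x] reach_subset[OF y] by (auto simp: merge_set_def simp del: reach.simps)
  have finK: "finite (?K j)" for j using KV fin finite_subset by blast
  have term_le: "real (card (\<Union>w\<in>?K j. reach V E w (m - j))) \<le>
      32 * d ^ (m - 1) + 8 * (d ^ (2 * m) / n) + 16 * l / e * d ^ (m - j - 1)" if j: "j < m" for j
  proof -
    have mj: "m - j = Suc (m - j - 1)" "m - j - 1 \<le> i" using j m by auto
    have "card (\<Union>w\<in>?K j. reach V E w (m - j)) \<le> (\<Sum>w\<in>?K j. card (reach V E w (m - j)))"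
      by (rule card_UN_le[OF finK])
    then have "real (card (\<Union>w\<in>?K j. reach V E w (m - j))) \<le> (\<Sum>w\<in>?K j. real (card (reach V E w (m - j))))"
      by (simp flip: of_nat_sum del: reach.simps)
    also have "\<dots> \<le> (\<Sum>w\<in>?K j. 4 * d ^ (m - j - 1))"
    proof (rule sum_mono)
      fix w assume "w \<in> ?K j"
      then have "w \<in> V" using KV by blast
      then show "real (card (reach V E w (m - j))) \<le> 4 * d ^ (m - j - 1)"
        using reach_le[of w "m - j - 1"] mj by simp
    qed
    also have "\<dots> = real (card (?K j)) * (4 * d ^ (m - j - 1))" by simp
    also have "\<dots> \<le> (8 * d ^ j + (2 * (d ^ (2 * j + 2) / n) + 4 * l / e)) * (4 * d ^ (m - j - 1))"
    proof (rule mult_right_mono)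
      have "card (?K j) \<le> card (reach V E x (Suc j)) + card (reach V E y (Suc j)) + card (merge_set V E x y j)"
        by (meson add_le_mono1 card_Un_le order_trans)
      then show "real (card (?K j)) \<le> 8 * d ^ j + (2 * (d ^ (2 * j + 2) / n) + 4 * l / e)"
        using reach_le[OF x, of j] reach_le[OF y, of j] merge_set_le[OF x y xy, of j] j m by linarith
    qed (use d_pos in simp)
    also have "\<dots> = 32 * d ^ (j + (m - j - 1)) + 8 * (d ^ (2 * j + 2 + (m - j - 1)) / n) + 16 * l / e * d ^ (m - j - 1)"
      by (simp add: power_add algebra_simps)
    also have "\<dots> \<le> 32 * d ^ (m - 1) + 8 * (d ^ (2 * m) / n) + 16 * l / e * d ^ (m - j - 1)"
    proof -
      \<comment> \<open>The exponent is \<open>m + j + 1\<close>, at most \<open>2 m\<close> because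
        \<open>j < m\<close>.\<close>
      have "d ^ (2 * j + 2 + (m - j - 1)) \<le> d ^ (2 * m)" using j d_ge_4 by (intro power_increasing) auto
      moreover have "j + (m - j - 1) = m - 1" using j by simp
      ultimately show ?thesis using n_pos by (simp add: divide_right_mono)
    qed
    finally show ?thesis .
  qed
  have "card (meet V E x y m) \<le> card (\<Union>j<m. \<Union>w\<in>?K j. reach V E w (m - j))"
  proof (rule card_mono[OF _ meet_subset[OF x y xy]])
    show "finite (\<Union>j<m. \<Union>w\<in>?K j. reach V E w (m - j))"
      using finK finite_reach KV by blast
  qed
  also have "\<dots> \<le> (\<Sum>j<m. card (\<Union>w\<in>?K j. reach V E w (m - j)))" by (rule card_UN_le) simp
  finally have "real (card (meet V E x y m)) \<le> (\<Sum>j<m. real (card (\<Union>w\<in>?K j. reach V E w (m - j))))"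
    by (simp flip: of_nat_sum del: reach.simps)
  also have "\<dots> \<le> (\<Sum>j<m. 32 * d ^ (m - 1) + 8 * (d ^ (2 * m) / n) + 16 * l / e * d ^ (m - j - 1))"
    using term_le by (intro sum_mono) auto
  also have "\<dots> = real m * (32 * d ^ (m - 1) + 8 * (d ^ (2 * m) / n)) + 16 * l / e * (\<Sum>j<m. d ^ (m - j - 1))"
    by (simp add: sum.distrib sum_distrib_left)
  finally have "d * real (card (meet V E x y m)) \<le>
      d * (real m * (32 * d ^ (m - 1) + 8 * (d ^ (2 * m) / n)) + 16 * l / e * (\<Sum>j<m. d ^ (m - j - 1)))"
    using d_pos by (intro mult_left_mono) auto
  also have "\<dots> = 32 * (real m * (d * d ^ (m - 1))) + 8 * real m * (d ^ (2 * m + 1) / n) +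
      16 * l / e * (d * (\<Sum>j<m. d ^ (m - j - 1)))"
    by (simp add: algebra_simps)
  also have "\<dots> \<le> 32 * (real m * d ^ m) + 8 * real m * (d ^ (2 * m + 1) / n) + 16 * l / e * (2 * d ^ m)"
  proof -
    have "real m * (d * d ^ (m - 1)) = real m * d ^ m" by (cases m) auto
    moreover have "16 * l / e * (d * (\<Sum>j<m. d ^ (m - j - 1))) \<le> 16 * l / e * (2 * d ^ m)"
      using sum_powers_le[of d m] d_ge_4 l e by (intro mult_left_mono) auto
    ultimately show ?thesis by linarith
  qed
  finally show ?thesis by (simp add: algebra_simps)
qed

text \<open>With \<open>m = i - 1\<close>, merges in the last step give the main term. The smaller
  balls, the additive errors and the neighbours of earlier meetings fit into two terms
  \<open>e D^2 / n\<close>, so \<open>9 + 1 + 1 = 11\<close>.\<close>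

lemma meet_final_le:
  assumes x: "x \<in> V" and y: "y \<in> V" and xy: "x \<noteq> y"
  shows "real (card (meet V E x y i)) \<le> (1 + 11 * e) * ((d ^ i)\<^sup>2 / n)"
proof -
  obtain m where m: "i = Suc m" using i_pos by (cases i) auto
  have meetV: "meet V E x y m \<subseteq> V" using reach_subset[OF x] by (auto simp: meet_def simp del: reach.simps)
  let ?U = "reach V E x (Suc m) \<union> reach V E y (Suc m) \<union> merge_set V E x y m"
  have "card (meet V E x y i) \<le> card (?U \<union> nbrs V E (meet V E x y m))"
    unfolding m
  proof (rule card_mono[OF _ meet_Suc_subset[OF x y]])
    show "finite (?U \<union> nbrs V E (meet V E x y m))"
      using fin finite_reach[OF x] finite_reach[OF y] by (simp add: merge_set_def nbrs_def del: reach.simps)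
  qed
  also have "\<dots> \<le> card (reach V E x (Suc m)) + card (reach V E y (Suc m)) + card (merge_set V E x y m) +
      card (nbrs V E (meet V E x y m))"
    by (meson add_le_mono1 card_Un_le order_trans)
  finally have "real (card (meet V E x y i)) \<le> 8 * d ^ m + real (card (merge_set V E x y m)) +
      real (card (nbrs V E (meet V E x y m)))"
    using reach_le[OF x, of m] reach_le[OF y, of m] m by linarith
  also have "real (card (nbrs V E (meet V E x y m))) \<le> real (card (meet V E x y m)) * (4 * d)"
  proof (rule card_nbrs_le[OF fin meetV])
    fix w assume "w \<in> meet V E x y m"
    then show "real (card (reach V E w 2)) \<le> 4 * d"
      using reach_le[of w 1] meetV i_pos by (auto simp: numeral_2_eq_2 simp del: reach.simps)
  qed
  also have "\<dots> \<le> 128 * real m * d ^ m + 32 * real m * (d ^ (2 * m + 1) / n) + 128 * l / e * d ^ m"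
  proof -
    have "real (card (meet V E x y m)) * (4 * d) = 4 * (d * real (card (meet V E x y m)))" by simp
    also have "\<dots> \<le> 4 * (32 * real m * d ^ m + 8 * real m * (d ^ (2 * m + 1) / n) + 32 * l / e * d ^ m)"
      using meet_le[OF x y xy, of m] m by (intro mult_left_mono) auto
    finally show ?thesis by simp
  qed
  also have "real (card (merge_set V E x y m)) \<le> (1 + 9 * e) * (d ^ (2 * m + 2) / n) + 4 * l / e"
    using merge_set_le_coeff[OF x y xy, of m] m by simp
  finally have "real (card (meet V E x y i)) \<le> (1 + 9 * e) * (d ^ (2 * m + 2) / n) +
      (4 * l / e + 8 * d ^ m + 128 * real m * d ^ m + 128 * l / e * d ^ m) + 32 * real m * (d ^ (2 * m + 1) / n)"
    by simp
  \<comment> \<open>Every term is at most a multiple of \<open>(l / e) d^m\<close>, and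
    \<open>132 + 136/10 < 150\<close>. The hypothesis \<open>next_large\<close> amounts to
    \<open>150 (l / e) d^m \<le> e d^(2m+2) / n\<close>.\<close>
  also have "4 * l / e + 8 * d ^ m + 128 * real m * d ^ m + 128 * l / e * d ^ m \<le> e * (d ^ (2 * m + 2) / n)"
  proof -
    have dm: "1 \<le> d ^ m" using d_ge_4 by simp
    have ml: "real m \<le> l" using i_le m by simp
    have le10: "10 * l \<le> l / e"
    proof -
      have "10 * e * l \<le> 1 * l" using e l by (intro mult_right_mono) auto
      then show ?thesis using e by (simp add: field_simps)
    qed
    have "4 * l / e + 8 * d ^ m + 128 * real m * d ^ m + 128 * l / e * d ^ m \<le>
        (4 * l / e) * d ^ m + (8 * l) * d ^ m + (128 * l) * d ^ m + 128 * l / e * d ^ m"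
    proof (intro add_mono order_refl)
      show "4 * l / e \<le> 4 * l / e * d ^ m" using dm e l mult_left_mono[of 1 "d ^ m" "4 * l / e"] by simp
      show "8 * d ^ m \<le> 8 * l * d ^ m" using dm l by (intro mult_right_mono) auto
      show "128 * real m * d ^ m \<le> 128 * l * d ^ m" using dm ml by (intro mult_right_mono) auto
    qed
    also have "\<dots> = (132 * (l / e) + 136 * l) * d ^ m" by (simp add: algebra_simps)
    also have "\<dots> \<le> (150 * (l / e)) * d ^ m" using le10 l dm by (intro mult_right_mono) linarith+
    also have "\<dots> \<le> e * (d ^ (2 * m + 2) / n)"
    proof -
      have "150 * (n * l) * d ^ m \<le> e\<^sup>2 * d ^ (i + 1) * d ^ m"
        using next_large dm by (intro mult_right_mono) auto
      also have "\<dots> = e\<^sup>2 * d ^ (2 * m + 2)" by (simp add: m power_add[symmetric] mult_2)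
      finally show ?thesis using n_pos e by (simp add: field_simps power2_eq_square)
    qed
    finally show ?thesis .
  qed
  \<comment> \<open>One factor \<open>d\<close> is to spare, and \<open>32 m \<le> e d\<close>
    follows from \<open>m \<le> l\<close> and
    \<open>16 l \<le> e^2 d \<le> e d / 10\<close>.\<close>
  also have "32 * real m * (d ^ (2 * m + 1) / n) \<le> e * (d ^ (2 * m + 2) / n)"
  proof -
    have "(10 * e) * (e * d) \<le> 1 * (e * d)" using e d_pos by (intro mult_right_mono) auto
    then have "10 * (e\<^sup>2 * d) \<le> e * d" by (simp add: power2_eq_square)
    moreover have "0 \<le> e * d" using e d_pos by simp
    moreover have "real m \<le> l" using i_le m by simp
    ultimately have "32 * real m \<le> e * d" using d_ge by linarith
    then have "32 * real m * (d ^ (2 * m + 1) / n) \<le> (e * d) * (d ^ (2 * m + 1) / n)"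
      using n_pos d_pos by (intro mult_right_mono) auto
    then show ?thesis by simp
  qed
  finally have "real (card (meet V E x y i)) \<le>
      (1 + 9 * e) * (d ^ (2 * m + 2) / n) + e * (d ^ (2 * m + 2) / n) + e * (d ^ (2 * m + 2) / n)"
    by simp
  also have "(1 + 9 * e) * (d ^ (2 * m + 2) / n) + e * (d ^ (2 * m + 2) / n) + e * (d ^ (2 * m + 2) / n) =
      (1 + 11 * e) * (d ^ (2 * m + 2) / n)"
    by (simp only: distrib_right[symmetric]) simp
  also have "2 * m + 2 = i * 2" using m by simp
  also have "d ^ (i * 2) = (d ^ i)\<^sup>2" by (rule power_mult)
  finally show ?thesis .
qed

end

section \<open>Union bounds\<close>

lemma reach_connected:
  assumes cut: "\<And>S. S \<subseteq> V \<Longrightarrow> S \<noteq> {} \<Longrightarrow> S \<noteq> V \<Longrightarrow> \<exists>a\<in>S. \<exists>z\<in>V - S. {a, z} \<in> E"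
    and x: "x \<in> V" and y: "y \<in> V"
  shows "\<exists>j. x \<in> reach V E y j"
proof (rule ccontr)
  assume no: "\<not> ?thesis"
  let ?S = "\<Union>j. reach V E y j"
  have sub: "?S \<subseteq> V" using reach_subset[OF y] by (simp add: UN_subset_iff)
  have ne: "?S \<noteq> {}" using self_in_reach[of y V E 0] by blast
  have "?S \<noteq> V" using no x by blast
  from cut[OF sub ne this] obtain a z j where az: "a \<in> reach V E y j" "z \<in> V" "z \<notin> ?S" "{a, z} \<in> E"
    by blast
  then show False using reach_step[OF az(1,4,2)] by blast
qed

section \<open>Number of queries on a graph with all the good properties\<close>

context expanding_graph
begin

lemma eq_num_bound:
  assumes E: "E \<subseteq> all_edges V" and l_eq: "l = ln n" and e_small: "e \<le> 1/20000" and l_large: "4096 \<le> l"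
    and dense: "\<And>U. U \<subseteq> V \<Longrightarrow> n \<le> 2 * real (card U) \<Longrightarrow> n * d / 20 \<le> real (card {f \<in> E. f \<subseteq> U})"
    and sparse: "\<And>x. x \<in> V \<Longrightarrow> real (card {f \<in> E. f \<subseteq> reach V E x (Suc i)}) \<le> d ^ i * d / 400"
    and cut: "\<And>S. S \<subseteq> V \<Longrightarrow> S \<noteq> {} \<Longrightarrow> S \<noteq> V \<Longrightarrow> \<exists>a\<in>S. \<exists>z\<in>V - S. {a, z} \<in> E"
  shows "ereal_of_enat (eq_num V E) \<le> ereal (2 * (n * l / d ^ i))"
proof -
  define D where "D = d ^ i"
  define k0 where "k0 = n * l / (2 * D)"
  define q where "q = 3/4 * D / n"
  define Y where "Y = n * l / D"
  have V: "V \<noteq> {}" using n_pos by (auto simp: n_def)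
  have D: "0 < D" using d_pos by (simp add: D_def)
  have dD: "d \<le> D" using d_ge_4 i_pos power_increasing[of 1 i d] by (simp add: D_def)
  have "e\<^sup>2 \<le> 1\<^sup>2" using e by (intro power_mono) auto
  then have "e\<^sup>2 * d \<le> 1 * d" using d_pos by (intro mult_right_mono) auto
  then have lD: "l \<le> D" using d_ge dD l by linarith
  have nD: "20000 * D \<le> n"
  proof -
    have "D \<le> e * n" using ball_small by (simp add: D_def)
    also have "\<dots> \<le> 1/20000 * n" using e_small n_pos by (intro mult_right_mono) auto
    finally show ?thesis by simp
  qed
  have Y: "20000 \<le> Y"
  proof -
    have "20000 * D * 1 \<le> n * l" using nD l n_pos by (intro mult_mono) auto
    then show ?thesis using D by (simp add: Y_def field_simps)
  qed
  have k0Y: "k0 = Y / 2" by (simp add: k0_def Y_def)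
  \<comment> \<open>Both phases and the offset 1 must fit below the rounded target:
    \<open>4/3 Y + Y/2 + 1 \<le> 2 Y - 1\<close>, which holds from \<open>Y \<ge> 12\<close>
    on.\<close>
  define t where "t = nat \<lfloor>2 * Y\<rfloor>"
  have t: "2 * Y - 1 \<le> real t" "real t \<le> 2 * Y" using Y by (auto simp: t_def)
  have "eq_num V E \<le> enat t"
  proof (rule eq_num_le_two_phases[OF fin, of q k0])
    show "0 < q" using D n_pos by (simp add: q_def)
    show "1 \<le> k0" using Y k0Y by simp
    have "n * l \<le> n * (2 * D)" using lD D n_pos by (intro mult_left_mono) auto
    then show "k0 \<le> real (card V)" using D by (simp add: k0_def n_def[symmetric] field_simps)
  next
    fix W assume W: "W \<subseteq> V" "k0 \<le> real (card W)"
    have "\<exists>u v. {u, v} \<in> E \<and> u \<in> V \<and> v \<in> V \<and>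
      3/4 * D / real (card V) * real (card W) \<le> real (card (W \<inter> reach V E u (Suc i) - reach V E v (Suc i))) \<and>
      3/4 * D / real (card V) * real (card W) \<le> real (card (W \<inter> reach V E v (Suc i) - reach V E u (Suc i)))"
    proof (rule balanced_edge[OF fin V W(1), where d = d])
      show "finite E" using E finite_all_edges[OF fin] finite_subset by blast
      show "reach V E x (Suc i) \<subseteq> V" if "x \<in> V" for x by (rule reach_subset[OF that])
      show "(y \<in> reach V E x (Suc i)) = (x \<in> reach V E y (Suc i))" if "x \<in> V" "y \<in> V" for x y
        using reach_sym[OF that] .
      show "0 < D" "0 < d" using D d_pos by auto
      show "(1 - 1/512) * D \<le> real (card (reach V E x (Suc i)))" if "x \<in> V" for x
      proof -
        have "(1 - 1/512) * D \<le> (1 - 15 * e) * D" using D e_small by (intro mult_right_mono) auto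
        then show ?thesis using reach_ge[OF that] by (simp add: D_def del: reach.simps)
      qed
      show "real (card (reach V E x (Suc i))) \<le> 4 * D" if "x \<in> V" for x
        using reach_le[OF that, of i] by (simp add: D_def del: reach.simps)
      show "real (card (reach V E x (Suc i) \<inter> reach V E y (Suc i))) \<le> (1 + 1/512) * D\<^sup>2 / real (card V)"
        if "x \<in> V" "y \<in> V" "x \<noteq> y" for x y
      proof -
        have "(1 + 11 * e) * (D\<^sup>2 / n) \<le> (1 + 1/512) * (D\<^sup>2 / n)"
          using D n_pos e_small by (intro mult_right_mono) auto
        then show ?thesis using meet_final_le[OF that] by (simp add: D_def meet_def n_def[symmetric] del: reach.simps)
      qed
      show "real (card V) * d / 20 \<le> real (card {f \<in> E. f \<subseteq> U})"
        if "U \<subseteq> V" "real (card V) \<le> 2 * real (card U)" for U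
        using dense that by (simp add: n_def)
      show "real (card {f \<in> E. f \<subseteq> reach V E x (Suc i)}) \<le> D * d / 400" if "x \<in> V" for x
        using sparse[OF that] by (simp add: D_def del: reach.simps)
      show "\<exists>u v. f = {u, v} \<and> u \<in> V \<and> v \<in> V" if "f \<in> E" for f
      proof -
        have "f \<subseteq> V" "card f = 2" using that E by (auto simp: all_edges_def)
        then show ?thesis by (auto simp: card_2_iff)
      qed
      \<comment> \<open>At the threshold, \<open>k0 * D / n\<close> equals \<open>l / 2\<close>;
        hence the requirement \<open>l \<ge> 4096\<close>.\<close>
      have "2048 * n \<le> n * l / 2" using l_large n_pos by simp
      also have "\<dots> = k0 * D" using D by (simp add: k0_def)
      also have "\<dots> \<le> real (card W) * D" using W(2) D by (intro mult_right_mono) auto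
      finally show "2048 * real (card V) \<le> real (card W) * D" by (simp add: n_def)
    qed
    then obtain u v where uv: "{u, v} \<in> E" "u \<in> V" "v \<in> V"
      "q * real (card W) \<le> real (card (W \<inter> reach V E u (Suc i) - reach V E v (Suc i)))"
      "q * real (card W) \<le> real (card (W \<inter> reach V E v (Suc i) - reach V E u (Suc i)))"
      unfolding q_def n_def by blast
    have finW: "finite W" using W(1) fin finite_subset by blast
    have "real (card (W \<inter> reach V E a (Suc i) - reach V E b (Suc i))) \<le>
        real (card {x \<in> W. gdist V E a x < gdist V E b x})" if "a \<in> V" "b \<in> V" for a b
      using finW gdist_less[OF that] by (intro of_nat_mono card_mono) auto
    then show "\<exists>u v. {u, v} \<in> E \<and> q * real (card W) \<le> real (card {x \<in> W. gdist V E u x < gdist V E v x})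
        \<and> q * real (card W) \<le> real (card {x \<in> W. gdist V E v x < gdist V E u x})"
      using uv by (meson order_trans)
  next
    fix W assume W: "W \<subseteq> V" "2 \<le> card W"
    then show "\<exists>u v. {u, v} \<in> E \<and> 1 \<le> card {x \<in> W. gdist V E u x < gdist V E v x}
        \<and> 1 \<le> card {x \<in> W. gdist V E v x < gdist V E u x}"
      using fin finite_subset by (intro separating_edge[of W V] reach_connected[OF cut]) blast+
  next
    \<comment> \<open>The crude bound \<open>n / k0 \<le> n\<close> replaces the logarithm by
      \<open>l\<close>; dividing by \<open>q\<close> then gives \<open>4/3 Y\<close>.\<close>
    have "n / k0 = 2 * D / l" using n_pos D l by (simp add: k0_def field_simps)
    also have "\<dots> \<le> n"
    proof -
      have "2 * D \<le> n * 1" using nD D by simp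
      also have "\<dots> \<le> n * l" using l n_pos by (intro mult_left_mono) auto
      finally show ?thesis using l by (simp add: field_simps)
    qed
    finally have "ln (n / k0) \<le> l" unfolding l_eq using n_pos Y k0Y by (intro ln_mono) auto
    then have "ln (n / k0) / q \<le> l / q" using D n_pos by (intro divide_right_mono) (auto simp: q_def)
    also have "\<dots> = 4/3 * Y" by (simp add: q_def Y_def)
    finally show "ln (real (card V) / k0) / q + k0 + 1 \<le> real t"
      using t Y k0Y unfolding n_def by linarith
  qed
  then have "ereal_of_enat (eq_num V E) \<le> ereal_of_enat (enat t)" by (simp only: ereal_of_enat_le_iff)
  also have "\<dots> \<le> ereal (2 * Y)" using t by simp
  finally show ?thesis by (simp add: Y_def D_def)
qed

end

lemma prob_ex_le:
  assumes "finite I" "\<And>x. x \<in> I \<Longrightarrow> measure_pmf.prob M {E. Q x E} \<le> c"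
  shows "measure_pmf.prob M {E. \<exists>x\<in>I. Q x E} \<le> real (card I) * c"
proof -
  have "{E. \<exists>x\<in>I. Q x E} = (\<Union>x\<in>I. {E. Q x E})" by blast
  then have "measure_pmf.prob M {E. \<exists>x\<in>I. Q x E} \<le> (\<Sum>x\<in>I. measure_pmf.prob M {E. Q x E})"
    using assms(1) by (simp add: measure_pmf.finite_measure_subadditive_finite)
  also have "\<dots> \<le> (\<Sum>x\<in>I. c)" using assms(2) by (rule sum_mono)
  finally show ?thesis by simp
qed

lemma card_all_edges: "finite U \<Longrightarrow> card (all_edges U) = card U choose 2"
  unfolding all_edges_def by (rule n_subsets)

lemma two_times_choose_two: "2 * (k choose 2) = k * (k - 1)"
  unfolding choose_two by (rule dvd_mult_div_cancel) (cases k; simp)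

lemma disjoint_singletons: "disjoint_family_on (\<lambda>f. {f}) Z"
  by (auto simp: disjoint_family_on_def)

lemma depends_on_member: "depends_on {f} (\<lambda>E. f \<in> E)"
  by (rule depends_onI) blast

section \<open>Failure probabilities of the good properties\<close>

context
  fixes V :: "'a set" and p n d l e :: real and i :: nat
  assumes fin: "finite V" and p: "0 \<le> p" "p \<le> 1" and n_def: "n = real (card V)" and n_large: "18 \<le> n"
    and d_def: "d = n * p" and l_eq: "l = ln n" and l_large: "4096 \<le> l" and e: "0 < e" "e \<le> 1/20000"
    and i_pos: "1 \<le> i" and i_le: "real i \<le> l" and d_ge_4: "4 \<le> d" and d_ge: "16 * l \<le> e\<^sup>2 * d"
    and ball_small: "d ^ i \<le> e * n" and next_large: "150 * (n * l) \<le> e\<^sup>2 * d ^ (i + 1)"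
begin

lemma finite_edges: "finite (all_edges V)"
  by (rule finite_all_edges[OF fin])

lemma exp_l: "exp (- l) = 1 / n"
  using n_large by (simp add: l_eq exp_minus inverse_eq_divide)

lemma exp_4l: "exp (- (4 * l)) = 1 / n ^ 4"
proof -
  have "exp (- (4 * l)) = exp (- l) ^ 4" by (simp add: exp_of_nat_mult[symmetric])
  then show ?thesis by (simp add: exp_l power_divide)
qed

lemma prob_ex_subset_le:
  assumes "s \<le> card V" and "\<And>S. S \<subseteq> V \<Longrightarrow> card S = s \<Longrightarrow> measure_pmf.prob M {E. Q S E} \<le> c"
  shows "measure_pmf.prob M {E. \<exists>S. S \<subseteq> V \<and> card S = s \<and> Q S E} \<le> exp (real s * l) * c"
proof -
  let ?I = "{S. S \<subseteq> V \<and> card S = s}"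
  have finI: "finite ?I" using fin by simp
  have c: "0 \<le> c"
  proof -
    obtain S where "S \<subseteq> V" "card S = s" using obtain_subset_with_card_n[OF assms(1)] by blast
    then show ?thesis using assms(2) measure_nonneg order_trans by blast
  qed
  have "measure_pmf.prob M {E. \<exists>S\<in>?I. Q S E} \<le> real (card ?I) * c"
    using assms(2) by (intro prob_ex_le[OF finI]) auto
  also have "\<dots> \<le> exp (real s * l) * c"
  proof (rule mult_right_mono[OF _ c])
    have "real (card ?I) = real (card V choose s)" by (simp add: n_subsets[OF fin])
    also have "\<dots> \<le> real (card V ^ s)" by (intro of_nat_mono binomial_le_pow assms(1))
    also have "\<dots> = exp (real s * l)" using n_large by (simp add: l_eq exp_of_nat_mult n_def)
    finally show "real (card ?I) \<le> exp (real s * l)" .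
  qed
  finally show ?thesis by (simp add: Bex_def conj_assoc)
qed

definition up_fails :: "'a \<Rightarrow> nat \<Rightarrow> 'a set set \<Rightarrow> bool" where
  "up_fails x j E \<longleftrightarrow> (1 + e / 2 ^ Suc j) * (n * (p * real (card (level V E x j)))) + 4 * l / (e / 2 ^ Suc j)
     \<le> real (card (level V E x (Suc j)))"

definition lo_fails :: "'a \<Rightarrow> nat \<Rightarrow> 'a set set \<Rightarrow> bool" where
  "lo_fails x j E \<longleftrightarrow> p * real (card (level V E x j)) \<le> 1 \<and> real (card (level V E x (Suc j))) \<le>
      (1 - e / 2 ^ Suc j) * ((n - real (card (reach V E x (Suc j)))) *
        (p * real (card (level V E x j)) - (p * real (card (level V E x j)))\<^sup>2)) - 4 * l / (e / 2 ^ Suc j)"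

definition mg_fails :: "'a \<Rightarrow> 'a \<Rightarrow> nat \<Rightarrow> 'a set set \<Rightarrow> bool" where
  "mg_fails x y j E \<longleftrightarrow> (1 + e) * (n * ((p * real (card (level V E x j))) * (p * real (card (level V E y j)))))
     + 4 * l / e \<le> real (card (merge_set V E x y j))"

lemma e_level: "0 < e / 2 ^ Suc j" "e / 2 ^ Suc j \<le> 1"
proof -
  have "1 \<le> (2::real) ^ Suc j" by (rule one_le_power) simp
  then show "0 < e / 2 ^ Suc j" "e / 2 ^ Suc j \<le> 1" using e by (auto simp: field_simps)
qed

lemma e_cancel: "0 < r \<Longrightarrow> - r * (4 * l / r) = - (4 * l)" for r
  by simp

lemma prob_up_fails: "x \<in> V \<Longrightarrow> measure_pmf.prob (random_graph V p) {E. up_fails x j E} \<le> 1 / n ^ 4"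
  using prob_level_upper[OF fin p, of x "e / 2 ^ Suc j" j "4 * l / (e / 2 ^ Suc j)"]
  unfolding up_fails_def n_def[symmetric] e_cancel[OF e_level(1)] exp_4l using e_level by blast

lemma prob_lo_fails: "x \<in> V \<Longrightarrow> measure_pmf.prob (random_graph V p) {E. lo_fails x j E} \<le> 1 / n ^ 4"
  using prob_level_lower[OF fin p, of x "e / 2 ^ Suc j" j "4 * l / (e / 2 ^ Suc j)"]
  unfolding lo_fails_def n_def[symmetric] e_cancel[OF e_level(1)] exp_4l using e_level by blast

lemma prob_mg_fails: "x \<in> V \<Longrightarrow> y \<in> V \<Longrightarrow> measure_pmf.prob (random_graph V p) {E. mg_fails x y j E} \<le> 1 / n ^ 4"
  using prob_merge_set[OF fin p, of x y e j "4 * l / e"] e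
  unfolding mg_fails_def n_def[symmetric] e_cancel[OF e(1)] exp_4l by simp

text \<open>At most \<open>n * n * i \<le> n^3\<close> choices of two vertices and a radius compete
  against \<open>1 / n^4\<close>; hence the 4 in the additive errors \<open>4 * l\<close>.\<close>

lemma prob_growth_fails:
  "measure_pmf.prob (random_graph V p) {E. \<exists>z\<in>(V \<times> V) \<times> {..<i}. up_fails (fst (fst z)) (snd z) E \<or>
     lo_fails (fst (fst z)) (snd z) E \<or> mg_fails (fst (fst z)) (snd (fst z)) (snd z) E} \<le> 3 / n"
proof -
  let ?Q = "\<lambda>z E. up_fails (fst (fst z)) (snd z) E \<or>
     lo_fails (fst (fst z)) (snd z) E \<or> mg_fails (fst (fst z)) (snd (fst z)) (snd z) E"
  have "measure_pmf.prob (random_graph V p) {E. \<exists>z\<in>(V \<times> V) \<times> {..<i}. ?Q z E} \<le>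
      real (card ((V \<times> V) \<times> {..<i})) * (3 / n ^ 4)"
  proof (rule prob_ex_le)
    fix z assume z: "z \<in> (V \<times> V) \<times> {..<i}"
    have "{E. ?Q z E} = {E. up_fails (fst (fst z)) (snd z) E} \<union> ({E. lo_fails (fst (fst z)) (snd z) E}
        \<union> {E. mg_fails (fst (fst z)) (snd (fst z)) (snd z) E})" by blast
    then have "measure_pmf.prob (random_graph V p) {E. ?Q z E} \<le> measure_pmf.prob (random_graph V p) {E. up_fails (fst (fst z)) (snd z) E} +
        (measure_pmf.prob (random_graph V p) {E. lo_fails (fst (fst z)) (snd z) E} +
         measure_pmf.prob (random_graph V p) {E. mg_fails (fst (fst z)) (snd (fst z)) (snd z) E})"
      by (simp only:) (intro order_trans[OF measure_Un_le] add_left_mono measure_Un_le; simp)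
    also have "\<dots> \<le> 1 / n ^ 4 + (1 / n ^ 4 + 1 / n ^ 4)"
      using z by (intro add_mono prob_up_fails prob_lo_fails prob_mg_fails) auto
    finally show "measure_pmf.prob (random_graph V p) {E. ?Q z E} \<le> 3 / n ^ 4" by simp
  qed (use fin in auto)
  also have "real (card ((V \<times> V) \<times> {..<i})) = n * n * real i"
    by (simp add: card_cartesian_product n_def)
  also have "n * n * real i * (3 / n ^ 4) \<le> n * n * n * (3 / n ^ 4)"
  proof (intro mult_right_mono mult_left_mono)
    show "real i \<le> n" using i_le ln_bound[of n] n_large by (simp add: l_eq)
  qed (use n_large in auto)
  also have "\<dots> = 3 / n" using n_large by (simp add: field_simps power_numeral_reduce)
  finally show ?thesis .
qed

text \<open>There are at most \<open>exp n\<close> sets \<open>U\<close>, each failing with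
  probability at most \<open>exp (- n d / 120) \<le> exp (- 2 n)\<close>. Half of the vertices span
  at least \<open>n^2 / 9\<close> pairs, and the constant 20 comes from
  \<open>3/4 * 1/9 - 1/30 = 1/20\<close>.\<close>

lemma prob_not_dense:
  "measure_pmf.prob (random_graph V p) {E. \<exists>U\<in>{U. U \<subseteq> V \<and> n \<le> 2 * real (card U)}.
     real (card {f \<in> all_edges U. f \<in> E}) \<le> n * d / 20} \<le> 1 / n"
proof -
  let ?I = "{U. U \<subseteq> V \<and> n \<le> 2 * real (card U)}"
  have "measure_pmf.prob (random_graph V p) {E. \<exists>U\<in>?I. real (card {f \<in> all_edges U. f \<in> E}) \<le> n * d / 20} \<le>
      real (card ?I) * exp (- (1/4) * (n * d / 30))"
  proof (rule prob_ex_le)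
    show "finite ?I" using fin by simp
    fix U assume U: "U \<in> ?I"
    then have UV: "U \<subseteq> V" "n / 2 \<le> real (card U)" by auto
    have finU: "finite U" using UV fin finite_subset by blast
    have sub: "all_edges U \<subseteq> all_edges V" using UV(1) by (auto simp: all_edges_def)
    have choose: "n * n / 9 \<le> real (card U choose 2)"
    proof -
      have "n * n / 9 \<le> (n / 2) * (n / 2 - 1) / 2"
      proof -
        have "n * 18 \<le> n * n" using n_large by (intro mult_left_mono) auto
        then show ?thesis by (simp add: field_simps)
      qed
      also have "\<dots> \<le> real (card U) * (real (card U) - 1) / 2"
        using UV(2) n_large by (intro divide_right_mono mult_mono) auto
      also have "\<dots> = real (card U choose 2)"
      proof -
        have "card U \<noteq> 0" using UV(2) n_large by auto
        then have "real (card U) * (real (card U) - 1) = real (card U * (card U - 1))"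
          by (simp add: of_nat_diff)
        also have "card U * (card U - 1) = 2 * (card U choose 2)"
          by (simp only: two_times_choose_two)
        finally show ?thesis by simp
      qed
      finally show ?thesis .
    qed
    have "n * d / 9 = p * (n * n / 9)" by (simp add: d_def)
    also have "\<dots> \<le> p * real (card U choose 2)" using choose p by (intro mult_left_mono) auto
    also have "\<dots> = (\<Sum>f\<in>all_edges U. p)" by (simp add: card_all_edges[OF finU])
    also have "\<dots> = (\<Sum>f\<in>all_edges U. measure_pmf.prob (random_graph V p) {E. f \<in> E})"
      using prob_member_random_subset[OF finite_edges _ p] sub by (intro sum.cong refl) auto
    finally have mean: "n * d / 9 \<le> (\<Sum>f\<in>all_edges U. measure_pmf.prob (random_graph V p) {E. f \<in> E})" .
    have "measure_pmf.prob (random_graph V p) {E. real (card {f \<in> all_edges U. f \<in> E}) \<le> (1 - 1/4) * (n * d / 9) - n * d / 30}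
        \<le> exp (- (1/4) * (n * d / 30))"
      by (rule chernoff_lower[OF finite_edges finite_all_edges[OF finU] depends_on_member disjoint_singletons mean])
        (use n_large d_ge_4 in auto)
    moreover have "(1 - 1/4) * (n * d / 9) - n * d / 30 = n * d / 20" by simp
    ultimately show "measure_pmf.prob (random_graph V p) {E. real (card {f \<in> all_edges U. f \<in> E}) \<le> n * d / 20}
        \<le> exp (- (1/4) * (n * d / 30))" by (simp only:)
  qed
  also have "\<dots> \<le> exp n * exp (- (2 * n))"
  proof (rule mult_mono)
    have "card ?I \<le> card (Pow V)" using fin by (intro card_mono) auto
    then have "real (card ?I) \<le> 2 ^ card V" using fin by (simp add: card_Pow flip: of_nat_le_iff)
    also have "\<dots> \<le> exp 1 ^ card V" using exp_ge_add_one_self[of 1] by (intro power_mono) auto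
    also have "\<dots> = exp n" by (simp add: exp_of_nat_mult[symmetric] n_def)
    finally show "real (card ?I) \<le> exp n" .
    have "e\<^sup>2 \<le> 1\<^sup>2" using e by (intro power_mono) auto
    then have "e\<^sup>2 * d \<le> 1 * d" using d_ge_4 by (intro mult_right_mono) auto
    then have "240 \<le> d" using d_ge l_large by linarith
    then have "n * 240 \<le> n * d" using n_large by (intro mult_left_mono) auto
    then show "exp (- (1/4) * (n * d / 30)) \<le> exp (- (2 * n))" by simp
  qed auto
  also have "\<dots> = exp (- n)" by (simp add: mult_exp_exp)
  also have "\<dots> \<le> exp (- l)" using ln_bound[of n] n_large by (simp add: l_eq)
  finally show ?thesis by (simp add: exp_l)
qed

lemma d_ge_l: "4800 * l \<le> d"
proof -
  have "e\<^sup>2 \<le> (1/20000)\<^sup>2" using e by (intro power_mono) auto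
  then have "e\<^sup>2 * d \<le> (1/20000)\<^sup>2 * d" using d_ge_4 by (intro mult_right_mono) auto
  then show ?thesis using d_ge l_large by (simp add: power2_eq_square)
qed

lemma d_le_power: "d \<le> d ^ i"
  using d_ge_4 i_pos power_increasing[of 1 i d] by simp

text \<open>Balls vary in size and are correlated with the edges inside them. Sparsity is therefore
  shown for all sets of one fixed size, large enough to contain any ball by
  \<open>reach_le\<close>.\<close>

definition ball_cap :: nat where "ball_cap = nat \<lceil>4 * d ^ i\<rceil>"

lemma ball_cap: "4 * d ^ i \<le> real ball_cap" "real ball_cap \<le> 5 * d ^ i" "ball_cap \<le> card V"
proof -
  have D: "4 \<le> d ^ i" using d_le_power d_ge_4 by linarith
  then show "4 * d ^ i \<le> real ball_cap" unfolding ball_cap_def by linarith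
  show s5: "real ball_cap \<le> 5 * d ^ i" using D unfolding ball_cap_def by linarith
  have "e * n \<le> 1/20000 * n" using e n_large by (intro mult_right_mono) auto
  then have "real ball_cap \<le> real (card V)" using s5 ball_small n_large unfolding n_def[symmetric] by linarith
  then show "ball_cap \<le> card V" by simp
qed

lemma prob_not_sparse:
  "measure_pmf.prob (random_graph V p) {E. \<exists>S. S \<subseteq> V \<and> card S = ball_cap \<and> d ^ i * d / 400 \<le> real (card {f \<in> all_edges S. f \<in> E})}
    \<le> 1 / n"
proof -
  let ?D = "d ^ i"
  have D: "1 \<le> ?D" using d_le_power d_ge_4 by linarith
  have "measure_pmf.prob (random_graph V p) {E. \<exists>S. S \<subseteq> V \<and> card S = ball_cap \<and> ?D * d / 400 \<le> real (card {f \<in> all_edges S. f \<in> E})}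
      \<le> exp (real ball_cap * l) * exp (- 1 * (?D * d / 800))"
  proof (rule prob_ex_subset_le[OF ball_cap(3)])
    fix S assume S: "S \<subseteq> V" "card S = ball_cap"
    have finS: "finite S" using S fin finite_subset by blast
    have sub: "all_edges S \<subseteq> all_edges V" using S(1) by (auto simp: all_edges_def)
    have "(\<Sum>f\<in>all_edges S. measure_pmf.prob (random_graph V p) {E. f \<in> E}) = (\<Sum>f\<in>all_edges S. p)"
      using prob_member_random_subset[OF finite_edges _ p] sub by (intro sum.cong refl) auto
    also have "\<dots> = p * real (ball_cap choose 2)" by (simp add: card_all_edges[OF finS] S(2))
    also have "\<dots> \<le> p * (real ball_cap * real ball_cap / 2)"
    proof (rule mult_left_mono[OF _ p(1)])
      have "2 * (ball_cap choose 2) = ball_cap * (ball_cap - 1)" by (rule two_times_choose_two)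
      also have "\<dots> \<le> ball_cap * ball_cap" by simp
      finally have "2 * real (ball_cap choose 2) \<le> real ball_cap * real ball_cap" by (metis of_nat_le_iff of_nat_mult of_nat_numeral)
      then show "real (ball_cap choose 2) \<le> real ball_cap * real ball_cap / 2" by simp
    qed
    also have "\<dots> \<le> p * ((5 * ?D) * (5 * ?D) / 2)"
      using ball_cap(2) p by (intro mult_left_mono divide_right_mono mult_mono) auto
    also have "\<dots> = 25/2 * (p * ?D) * ?D" by simp
    \<comment> \<open>Here \<open>e \<le> 1/20000\<close> brings the mean down to
      \<open>D d / 1600\<close>. Doubling it and adding a deviation \<open>D d / 800\<close> gives
      \<open>D d / 400\<close>.\<close>
    also have "\<dots> \<le> 25/2 * (d / 20000) * ?D"
    proof -
      have "e * n \<le> 1/20000 * n" using e n_large by (intro mult_right_mono) auto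
      then have "p * ?D \<le> p * (1/20000 * n)"
        using p(1) ball_small by (intro mult_left_mono) linarith+
      then show ?thesis using D by (intro mult_right_mono mult_left_mono) (auto simp: d_def mult.commute)
    qed
    also have "\<dots> = ?D * d / 1600" by simp
    finally have mean: "(\<Sum>f\<in>all_edges S. measure_pmf.prob (random_graph V p) {E. f \<in> E}) \<le> ?D * d / 1600" .
    have "measure_pmf.prob (random_graph V p) {E. (1 + 1) * (?D * d / 1600) + ?D * d / 800 \<le> real (card {f \<in> all_edges S. f \<in> E})}
        \<le> exp (- 1 * (?D * d / 800))"
      by (rule chernoff_upper[OF finite_edges finite_all_edges[OF finS] depends_on_member disjoint_singletons mean])
        auto
    moreover have "(1 + 1) * (?D * d / 1600) + ?D * d / 800 = ?D * d / 400" by simp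
    ultimately show "measure_pmf.prob (random_graph V p) {E. ?D * d / 400 \<le> real (card {f \<in> all_edges S. f \<in> E})}
        \<le> exp (- 1 * (?D * d / 800))" by (simp only:)
  qed
  also have "\<dots> = exp (real ball_cap * l - ?D * d / 800)" by (simp add: mult_exp_exp)
  \<comment> \<open>The union bound costs at most \<open>5 D l\<close> in the exponent, while
    \<open>d \<ge> 4800 l\<close> makes the gain \<open>D d / 800\<close> at least
    \<open>6 D l\<close>.\<close>
  also have "\<dots> \<le> exp (- l)"
  proof -
    have "real ball_cap * l \<le> 5 * ?D * l" using ball_cap(2) l_large by (intro mult_right_mono) auto
    moreover have "?D * (4800 * l) \<le> ?D * d" using d_ge_l D by (intro mult_left_mono) auto
    moreover have "1 * l \<le> ?D * l" using D l_large by (intro mult_right_mono) auto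
    ultimately show ?thesis by (simp only: exp_le_cancel_iff)
  qed
  finally show ?thesis by (simp add: exp_l)
qed

definition no_cross :: "'a set \<Rightarrow> 'a set set \<Rightarrow> bool" where
  "no_cross S E \<longleftrightarrow> (\<forall>a\<in>S. \<forall>z\<in>V - S. {a, z} \<notin> E)"

text \<open>At least \<open>card S * n / 2\<close> pairs cross the cut. Since
  \<open>d / 2 \<ge> 3 l\<close>, the bound beats the at most \<open>exp (s * l)\<close> sets of
  size \<open>s\<close>.\<close>

lemma prob_no_cross:
  assumes S: "S \<subseteq> V" and small: "2 * card S \<le> card V"
  shows "measure_pmf.prob (random_graph V p) {E. no_cross S E} \<le> exp (- (real (card S) * (3 * l)))"
proof -
  let ?F = "(\<lambda>(a, z). {a, z}) ` (S \<times> (V - S))"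
  have finS: "finite S" using S fin finite_subset by blast
  have "{E. no_cross S E} = {E. \<forall>f\<in>?F. f \<notin> E}" by (auto simp: no_cross_def)
  moreover have "?F \<subseteq> all_edges V" using S by (auto simp: pair_in_all_edges)
  ultimately have "measure_pmf.prob (random_graph V p) {E. no_cross S E} = (1 - p) ^ card ?F"
    using prob_none[OF fin p, of ?F] by simp
  also have "card ?F = card S * (card V - card S)"
  proof -
    have "inj_on (\<lambda>(a, z). {a, z}) (S \<times> (V - S))"
      by (auto simp: inj_on_def doubleton_eq_iff)
    then show ?thesis using S finS by (simp add: card_image card_cartesian_product card_Diff_subset)
  qed
  also have "(1 - p) ^ (card S * (card V - card S)) \<le> exp (- p) ^ (card S * (card V - card S))"
    using p exp_ge_add_one_self[of "- p"] by (intro power_mono) auto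
  also have "\<dots> = exp (- (real (card S) * (p * (n - real (card S)))))"
    using card_mono[OF fin S]
    by (simp add: exp_of_nat_mult[symmetric] n_def of_nat_diff algebra_simps)
  also have "\<dots> \<le> exp (- (real (card S) * (3 * l)))"
  proof -
    have "2 * real (card S) \<le> n" using small by (simp add: n_def)
    then have "p * (n / 2) \<le> p * (n - real (card S))" using p by (intro mult_left_mono) auto
    moreover have "3 * l \<le> p * (n / 2)" using d_ge_l l_large by (simp add: d_def mult.commute)
    ultimately have "real (card S) * (3 * l) \<le> real (card S) * (p * (n - real (card S)))"
      by (intro mult_left_mono) auto
    then show ?thesis by simp
  qed
  finally show ?thesis .
qed

lemma prob_disconnected:
  "measure_pmf.prob (random_graph V p) {E. \<exists>s\<in>{1..card V}. \<exists>S. S \<subseteq> V \<and> card S = s \<and> 2 * card S \<le> card V \<and> no_cross S E} \<le> 1 / n"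
proof -
  have "measure_pmf.prob (random_graph V p) {E. \<exists>s\<in>{1..card V}. \<exists>S. S \<subseteq> V \<and> card S = s \<and> 2 * card S \<le> card V \<and> no_cross S E}
      \<le> real (card {1..card V}) * exp (- (2 * l))"
  proof (rule prob_ex_le)
    fix s assume s: "s \<in> {1..card V}"
    have "measure_pmf.prob (random_graph V p) {E. \<exists>S. S \<subseteq> V \<and> card S = s \<and> 2 * card S \<le> card V \<and> no_cross S E}
        \<le> exp (real s * l) * exp (- (real s * (3 * l)))"
    proof (rule prob_ex_subset_le)
      fix S assume "S \<subseteq> V" "card S = s"
      then show "measure_pmf.prob (random_graph V p) {E. 2 * card S \<le> card V \<and> no_cross S E} \<le> exp (- (real s * (3 * l)))"
        using prob_no_cross[of S] by (cases "2 * card S \<le> card V") auto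
    qed (use s in simp)
    also have "\<dots> = exp (- (real s * (2 * l)))" by (simp add: mult_exp_exp algebra_simps)
    also have "\<dots> \<le> exp (- (1 * (2 * l)))"
    proof -
      have "1 * (2 * l) \<le> real s * (2 * l)" using s l_large by (intro mult_right_mono) auto
      then show ?thesis by simp
    qed
    finally show "measure_pmf.prob (random_graph V p) {E. \<exists>S. S \<subseteq> V \<and> card S = s \<and> 2 * card S \<le> card V \<and> no_cross S E}
        \<le> exp (- (2 * l))" by simp
  qed simp
  also have "\<dots> = n * (exp (- l) * exp (- l))" by (simp add: mult_exp_exp n_def)
  also have "\<dots> = 1 / n" using n_large by (simp add: exp_l)
  finally show ?thesis .
qed

lemma prob_eq_num_large:
  "measure_pmf.prob (random_graph V p) {E. \<not> ereal_of_enat (eq_num V E) \<le> ereal (2 * (n * l / d ^ i))} \<le> 6 / n"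
proof -
  define F1 where "F1 = {E. \<exists>z\<in>(V \<times> V) \<times> {..<i}. up_fails (fst (fst z)) (snd z) E \<or>
     lo_fails (fst (fst z)) (snd z) E \<or> mg_fails (fst (fst z)) (snd (fst z)) (snd z) E}"
  define F2 where "F2 = {E. \<exists>U\<in>{U. U \<subseteq> V \<and> n \<le> 2 * real (card U)}.
     real (card {f \<in> all_edges U. f \<in> E}) \<le> n * d / 20}"
  define F3 where "F3 = {E. \<exists>S. S \<subseteq> V \<and> card S = ball_cap \<and> d ^ i * d / 400 \<le> real (card {f \<in> all_edges S. f \<in> E})}"
  define F4 where "F4 = {E. \<exists>s\<in>{1..card V}. \<exists>S. S \<subseteq> V \<and> card S = s \<and> 2 * card S \<le> card V \<and> no_cross S E}"
  have good: "ereal_of_enat (eq_num V E) \<le> ereal (2 * (n * l / d ^ i))"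
    if E: "E \<subseteq> all_edges V" and F: "E \<notin> F1" "E \<notin> F2" "E \<notin> F3" "E \<notin> F4" for E
  proof -
    have e': "e \<le> 1/20000" by (rule e(2))
    have growth: "\<not> up_fails x j E" "\<not> lo_fails x j E" "\<not> mg_fails x y j E"
      if "x \<in> V" "y \<in> V" "j < i" for x y j
      using F(1) that by (auto simp: F1_def)
    interpret expanding_graph V E p n d l e i
    proof
      show "real (card (level V E x (Suc j))) <
          (1 + e / 2 ^ Suc j) * (n * (p * real (card (level V E x j)))) + 4 * l / (e / 2 ^ Suc j)"
        if "x \<in> V" "j < i" for x j
        using growth(1)[OF that(1,1,2)] unfolding up_fails_def by linarith
      show "(1 - e / 2 ^ Suc j) * ((n - real (card (reach V E x (Suc j)))) *
          (p * real (card (level V E x j)) - (p * real (card (level V E x j)))\<^sup>2)) - 4 * l / (e / 2 ^ Suc j)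
          < real (card (level V E x (Suc j)))"
        if "x \<in> V" "j < i" "p * real (card (level V E x j)) \<le> 1" for x j
        using growth(2)[OF that(1,1,2)] that(3) unfolding lo_fails_def by linarith
      show "real (card (merge_set V E x y j)) <
          (1 + e) * (n * ((p * real (card (level V E x j))) * (p * real (card (level V E y j))))) + 4 * l / e"
        if "x \<in> V" "y \<in> V" "x \<noteq> y" "j < i" for x y j
        using growth(3)[OF that(1,2,4)] unfolding mg_fails_def by linarith
    qed (use fin n_def n_large d_def e d_ge_4 d_ge l_large i_le i_pos ball_small next_large in auto)
    have inside: "{f \<in> E. f \<subseteq> U} = {f \<in> all_edges U. f \<in> E}" for U
      using E by (auto simp: all_edges_def)
    have finE: "finite E" using E finite_edges finite_subset by blast
    show ?thesis
    proof (rule eq_num_bound[OF E l_eq e' l_large])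
      show "n * d / 20 \<le> real (card {f \<in> E. f \<subseteq> U})" if "U \<subseteq> V" "n \<le> 2 * real (card U)" for U
      proof -
        have "\<not> real (card {f \<in> all_edges U. f \<in> E}) \<le> n * d / 20"
          using F(2) that unfolding F2_def by blast
        then show ?thesis unfolding inside by linarith
      qed
    next
      fix x assume x: "x \<in> V"
      have "real (card (reach V E x (Suc i))) \<le> real ball_cap" using reach_le[OF x, of i] ball_cap(1) by linarith
      then have "card (reach V E x (Suc i)) \<le> ball_cap" by simp
      \<comment> \<open>The ball is padded to exactly \<open>ball_cap\<close> vertices, which can
        only add edges.\<close>
      then obtain S where S: "reach V E x (Suc i) \<subseteq> S" "S \<subseteq> V" "card S = ball_cap"
        using exists_subset_between[OF _ ball_cap(3) reach_subset[OF x] fin] by blast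
      have "real (card {f \<in> E. f \<subseteq> reach V E x (Suc i)}) \<le> real (card {f \<in> E. f \<subseteq> S})"
        using S(1) finE by (intro of_nat_mono card_mono) auto
      also have "real (card {f \<in> E. f \<subseteq> S}) < d ^ i * d / 400"
      proof -
        have "\<not> d ^ i * d / 400 \<le> real (card {f \<in> all_edges S. f \<in> E})"
          using F(3) S(2,3) unfolding F3_def by blast
        then show ?thesis unfolding inside by linarith
      qed
      finally show "real (card {f \<in> E. f \<subseteq> reach V E x (Suc i)}) \<le> d ^ i * d / 400"
        by (rule less_imp_le)
    next
      fix S assume S: "S \<subseteq> V" "S \<noteq> {}" "S \<noteq> V"
      have no: "\<not> no_cross T E" if T: "T \<subseteq> V" "T \<noteq> {}" "2 * card T \<le> card V" for T
      proof -
        have "finite T" using T(1) fin finite_subset by blast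
        then have "card T \<in> {1..card V}" using T card_mono[OF fin T(1)] by (simp add: Suc_le_eq card_gt_0_iff)
        then show ?thesis using F(4) T unfolding F4_def by blast
      qed
      have finS: "finite S" using S(1) fin finite_subset by blast
      show "\<exists>a\<in>S. \<exists>z\<in>V - S. {a, z} \<in> E"
      proof (cases "2 * card S \<le> card V")
        case True
        then show ?thesis using no[OF S(1,2)] by (auto simp: no_cross_def)
      next
        case False
        \<comment> \<open>A cut can be read from either side, so the smaller one may be
          used.\<close>
        have "card (V - S) = card V - card S" by (rule card_Diff_subset[OF finS S(1)])
        then have "2 * card (V - S) \<le> card V" using False by simp
        then have "\<not> no_cross (V - S) E" using S by (intro no) auto
        then obtain z a where "z \<in> V - S" "a \<in> V - (V - S)" "{z, a} \<in> E" by (auto simp: no_cross_def)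
        then show ?thesis by (metis Diff_iff insert_commute)
      qed
    qed
  qed
  have "measure_pmf.prob (random_graph V p) {E. \<not> ereal_of_enat (eq_num V E) \<le> ereal (2 * (n * l / d ^ i))} \<le>
      measure_pmf.prob (random_graph V p) (F1 \<union> (F2 \<union> (F3 \<union> F4)))"
    using good set_random_subset[OF finite_edges, of p]
    by (intro measure_pmf.finite_measure_mono_AE AE_pmfI) auto
  also have "\<dots> \<le> measure_pmf.prob (random_graph V p) F1 + (measure_pmf.prob (random_graph V p) F2 + (measure_pmf.prob (random_graph V p) F3 + measure_pmf.prob (random_graph V p) F4))"
    by (intro order_trans[OF measure_Un_le] add_left_mono measure_Un_le; simp)
  also have "\<dots> \<le> 3 / n + (1 / n + (1 / n + 1 / n))"
    unfolding F1_def F2_def F3_def F4_def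
    by (intro add_mono prob_growth_fails prob_not_dense prob_not_sparse prob_disconnected)
  also have "\<dots> = 6 / n" by simp
  finally show ?thesis .
qed

end

section \<open>From fixed constants to the asymptotic statement\<close>

lemma gnp_eq_random_subset: "gnp n p = random_subset (all_edges {1..n}) p"
  by (simp add: gnp_def random_subset_def all_edges_def)

theorem theorem3p5:
  fixes p d \<omega> \<omega>_hat :: "nat \<Rightarrow> real" and i :: "nat \<Rightarrow> nat"
  assumes p_prob: "\<And>n. 0 \<le> p n \<and> p n \<le> 1"
    and d_eq: "\<And>n. d n = p n * real n"
    and omega_lim: "filterlim \<omega> at_top sequentially"
    and omega_le: "\<forall>\<^sub>F n in sequentially. \<omega> n \<le> ln (real n)"
    and d_lower: "\<forall>\<^sub>F n in sequentially. \<omega> n * ln (real n) \<le> d n"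
    and d_upper: "\<forall>\<^sub>F n in sequentially. d n \<le> real n / \<omega> n"
    and i_largest: "largest_exponent d i"
    and omega_hat_eq: "\<And>n. \<omega>_hat n = min (sqrt (\<omega> n)) (real n / d n ^ i n)"
    and d_large: "(\<lambda>n. \<omega>_hat n * ln (real n)) \<in> o(\<lambda>n. d n ^ (i n + 1) / real n)"
  shows "\<exists>\<epsilon> :: nat \<Rightarrow> real. \<epsilon> \<longlonglongrightarrow> 0 \<and>
    aas (\<lambda>n. gnp n (p n))
      (\<lambda>n E. ereal_of_enat (eq_num {1..n} E)
               \<le> ereal ((2 + \<epsilon> n) * (real n * ln (real n) / d n ^ i n))) \<and>
    (\<lambda>n. (2 + \<epsilon> n) * (real n * ln (real n) / d n ^ i n))
      \<in> O(\<lambda>n. real n * ln (real n) / d n ^ i n)"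
proof -
  \<comment> \<open>A fixed \<open>e\<close> suffices, since each little-o hypothesis eventually
    beats a given constant; the slack in the query count then allows the error function 0.\<close>
  define e :: real where "e = 1/20000"
  have e: "0 < e" and e2: "0 < e\<^sup>2 / 150" by (simp_all add: e_def)
  have i_pos: "1 \<le> i n" for n using i_largest by (simp add: largest_exponent_def)
  have small: "(\<lambda>n. d n ^ i n) \<in> o(\<lambda>n. real n)" using i_largest by (simp add: largest_exponent_def)
  let ?P = "\<lambda>n E. ereal_of_enat (eq_num {1..n} E) \<le> ereal ((2 + 0) * (real n * ln (real n) / d n ^ i n))"
  have ln_lim: "filterlim (\<lambda>n. ln (real n)) at_top sequentially"
    by (rule filterlim_compose[OF ln_at_top filterlim_real_sequentially])
  have ev: "\<forall>\<^sub>F n in sequentially. 1 - 6 / real n \<le> measure_pmf.prob (gnp n (p n)) {E. ?P n E}"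
    using d_lower eventually_ge_at_top[of 18]
      ln_lim[unfolded filterlim_at_top, rule_format, of 4096]
      omega_lim[unfolded filterlim_at_top, rule_format, of "16 / e\<^sup>2"]
      landau_o.smallD[OF small e]
      landau_o.smallD[OF d_large e2]
  proof eventually_elim
    case (elim n)
    have n: "18 \<le> real n" using elim(2) by simp
    have l: "4096 \<le> ln (real n)" using elim(3) .
    have dl: "16 * ln (real n) \<le> e\<^sup>2 * d n"
    proof -
      have "16 / e\<^sup>2 * ln (real n) \<le> \<omega> n * ln (real n)" using elim(4) l by (intro mult_right_mono) auto
      also have "\<dots> \<le> d n" by (rule elim(1))
      finally show ?thesis using e by (simp add: field_simps)
    qed
    have "e\<^sup>2 * d n \<le> 1 * d n" if "0 \<le> d n" 
      using that by (intro mult_right_mono) (auto simp: e_def power2_eq_square)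
    moreover have d0: "0 \<le> d n" using p_prob[of n] by (simp add: d_eq)
    ultimately have d4: "4 \<le> d n" using dl l by linarith
    have Dn: "d n ^ i n \<le> e * real n" using elim(5) d0 by simp
    \<comment> \<open>As \<open>d \<ge> 4\<close> exceeds \<open>exp 1\<close>, the bound
      \<open>d^i \<le> n\<close> forces \<open>i \<le> ln n\<close>.\<close>
    have "exp 1 ^ i n \<le> d n ^ i n"
      using d4 exp_le by (intro power_mono) auto
    also have "\<dots> \<le> 1 * real n" using Dn by (rule order_trans) (simp add: e_def)
    finally have "exp (real (i n)) \<le> real n" by (simp add: exp_of_nat_mult[symmetric])
    then have il: "real (i n) \<le> ln (real n)" using n by (simp add: ln_ge_iff)
    \<comment> \<open>With \<open>\<omega>_hat \<ge> 1\<close> the lower bound on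
      \<open>d^(i+1) / n\<close> becomes \<open>next_large\<close>; the little-o was instantiated
      with \<open>e^2 / 150\<close> for this purpose.\<close>
    have hat: "1 \<le> \<omega>_hat n"
    proof -
      have "16 / e\<^sup>2 \<ge> 1" by (simp add: e_def power2_eq_square)
      then have "1 \<le> \<omega> n" using elim(4) by linarith
      moreover have "1 \<le> real n / d n ^ i n"
        using Dn d4 n by (simp add: le_divide_eq e_def)
      ultimately show ?thesis by (simp add: omega_hat_eq)
    qed
    have next_large: "150 * (real n * ln (real n)) \<le> e\<^sup>2 * d n ^ (i n + 1)"
    proof -
      have "1 * ln (real n) \<le> \<omega>_hat n * ln (real n)" using hat l by (intro mult_right_mono) auto
      also have "\<dots> \<le> e\<^sup>2 / 150 * (d n ^ (i n + 1) / real n)"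
      proof -
        have "norm (d n ^ (i n + 1) / real n) = d n ^ (i n + 1) / real n" using d0 by simp
        then show ?thesis using elim(6) by (metis norm_ge_zero abs_ge_self order_trans real_norm_def)
      qed
      finally show ?thesis using n by (simp add: field_simps)
    qed
    have "measure_pmf.prob (gnp n (p n)) {E. \<not> ?P n E} \<le> 6 / real n"
      using prob_eq_num_large[of "{1..n}" "p n" "real n" "d n" "ln (real n)" e "i n"]
        p_prob[of n] n l dl d4 Dn il next_large i_pos[of n] e
      by (simp add: gnp_eq_random_subset d_eq mult.commute e_def)
    moreover have "measure_pmf.prob (gnp n (p n)) {E. \<not> ?P n E} = 1 - measure_pmf.prob (gnp n (p n)) {E. ?P n E}"
      using measure_pmf.prob_compl[of "{E. ?P n E}" "gnp n (p n)"]
      by (simp add: Compl_eq_Diff_UNIV[symmetric] Collect_neg_eq)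
    ultimately show ?case by linarith
  qed
  have lim: "(\<lambda>n. 1 - 6 / real n) \<longlonglongrightarrow> 1"
    using tendsto_diff[OF tendsto_const[of 1] lim_const_over_n[of 6]] by simp
  have "aas (\<lambda>n. gnp n (p n)) ?P"
    unfolding aas_def by (rule tendsto_sandwich[OF ev _ lim tendsto_const]) simp
  moreover have "(\<lambda>n. (2 + 0) * (real n * ln (real n) / d n ^ i n)) \<in> O(\<lambda>n. real n * ln (real n) / d n ^ i n)"
    by (rule bigoI[of _ 2]) (simp add: abs_mult)
  ultimately show ?thesis by (intro exI[of _ "\<lambda>_. 0"] conjI tendsto_const)
qed

end
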